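(* Let $G$ be a finite group acting linearly on $\mathbb{R}^n$, and let $$f(x)=\sum_{\alpha\in\mathcal{A}}c_\alpha\exp(\langle\alpha,x\rangle)+\sum_{\beta\in\mathcal{B}}c_\beta\exp(\langle\beta,x\rangle)$$ be a $G$-invariant signomial, where $\mathcal{A},\mathcal{B}\subset\mathbb{R}^n$ are disjoint nonempty finite sets, $c_\alpha>0$ for all $\alpha\in\mathcal{A}$ and $c_\beta<0$ for all $\beta\in\mathcal{B}$. Let $\hat{\mathcal{A}}$ and $\hat{\mathcal{B}}$ be sets of orbit representatives for $\mathcal{A}$ and $\mathcal{B}$. Then $f\in C_{\mathrm{SAGE}}(\mathcal{A},\mathcal{B})$ if and only if for every $\hat\beta\in\hat{\mathcal{B}}$ there exist $c^{(\hat\beta)}\in\mathbb{R}_+^{\mathcal{A}/\mathrm{Stab}(\hat\beta)}$ and $\nu^{(\hat\beta)}\in\mathbb{R}_+^{\mathcal{A}/\mathrm{Stab}(\hat\beta)}$ such that $$\sum_{\alpha\in\mathcal{A}/\mathrm{Stab}(\hat\beta)}\nu^{(\hat\beta)}_\alpha\sum_{\alpha'\in\mathrm{Stab}(\hat\beta)\cdot\alpha}(\alpha'-\hat\beta)=0\quad\text{for every }\hat\beta\in\hat{\mathcal{B}},$$ $$\sum_{\alpha\in\mathcal{A}/\mathrm{Stab}(\hat\beta)}\big|\mathrm{Stab}(\hat\beta)\cdot\alpha\big|\,\nu^{(\hat\beta)}_\alpha\ln\frac{\nu^{(\hat\beta)}_\alpha}{e\,c^{(\hat\beta)}_\alpha}\le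 c_{\hat\beta}\quad\text{for every }\hat\beta\in\hat{\mathcal{B}},$$ $$\sum_{\hat\beta\in\hat{\mathcal{B}}}\frac{|\mathrm{Stab}(\alpha)|}{|\mathrm{Stab}(\hat\beta)|}\sum_{\gamma\in(G\cdot\alpha)/\mathrm{Stab}(\hat\beta)}\big|\mathrm{Stab}(\hat\beta)\cdot\gamma\big|\,c^{(\hat\beta)}_\gamma\le c_\alpha\quad\text{for every }\alpha\in\hat{\mathcal{A}}.$$
   Context: Actions. $G$ acts linearly on $\mathbb{R}^n$ (the space of variables) on the left via a homomorphism $\varphi:G\to\mathrm{GL}_n(\mathbb{R})$, $\sigma(x)=\varphi(\sigma)(x)$. It acts on functions by $(\sigma f)(x)=f(\sigma^{-1}(x))$, and on exponent vectors $\alpha\in\mathbb{R}^n$ by the dual action $\sigma(\alpha)=\varphi(\sigma^{-1})^{\#}(\alpha)$, where $A^{\#}$ is the adjoint of $A$ with respect to the standard Euclidean inner product $\langle\cdot,\cdot\rangle$. Thus $\sigma$ maps $\sum_\alpha c_\alpha e^{\langle\alpha,x\rangle}$ to $\sum_\alpha c_\alpha e^{\langle\sigma(\alpha),x\rangle}$. A $G$-invariant $f$ satisfies $\sigma f=f$ for all $\sigma\in G$ (so, because of the sign conditions, $\mathcal{A}$ and $\mathcal{B}$ are $G$-stable). Orbits. A set of orbit representatives for a $G$-stable set $\mathcal{S}$ of exponents is an inclusion-minimal subset $\hat{\mathcal{S}}\subset\mathcal{S}$ with $G\cdot\hat{\mathcal{S}}=\mathcal{S}$ (exactly one element per orbit).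 $\mathrm{Stab}(\beta)=\{\sigma\in G:\sigma(\beta)=\beta\}$ (dual action). For a set $\mathcal{S}$ of exponents stable under a subgroup $H\le G$, $\mathcal{S}/H$ denotes the set of $H$-orbits in $\mathcal{S}$; a sum over $\alpha\in\mathcal{S}/H$ runs over one representative $\alpha$ per orbit, $H\cdot\alpha$ is the $H$-orbit of $\alpha$, and $v_\alpha$ for $v\in\mathbb{R}_+^{\mathcal{S}/H}$ denotes the (nonnegative) entry of $v$ at the orbit of $\alpha$. $G\cdot\alpha$ is the $G$-orbit of $\alpha$. Conventions. $0\cdot\ln\frac0y=0$ for $y\ge0$ and $y\cdot\ln\frac y0=\infty$ for $y>0$; $e$ is Euler's number. Cones. For a finite set $\mathcal{A}'\subset\mathbb{R}^n$ and $\beta\in\mathbb{R}^n\setminus\mathcal{A}'$, $C_{\mathrm{AGE}}(\mathcal{A}',\beta)$ is the set of functions $\sum_{\alpha\in\mathcal{A}'}c_\alpha e^{\langle\alpha,x\rangle}+c_\beta e^{\langle\beta,x\rangle}$ with $c_\alpha\ge0$ for $\alpha\in\mathcal{A}'$, $c_\beta\in\mathbb{R}$, that are nonnegative on $\mathbb{R}^n$. For disjoint finite $\mathcal{A}\ne\emptyset$ and $\mathcal{B}$, the signed SAGE cone is the Minkowski sum $C_{\mathrm{SAGE}}(\mathcal{A},\mathcal{B})=\sum_{\beta\in\mathcal{B}}C_{\mathrm{AGE}}\big((\mathcal{A}\cup\mathcal{B})\setminus\{\beta\},\beta\big)$. *)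

theory Defs
  imports
    "HOL-Analysis.Analysis"
    "HOL-Algebra.Group_Action"
    "HOL-Library.Set_Algebras"
    "HOL-Library.Function_Algebras"
begin

definition GL :: "(real ^ 'n ^ 'n) monoid" where
  "GL = \<lparr>carrier = {M. invertible M}, monoid.mult = (**), one = mat 1\<rparr>"

definition dual_act ::
  "('g, 'm) monoid_scheme \<Rightarrow> ('g \<Rightarrow> real ^ 'n ^ 'n) \<Rightarrow> 'g \<Rightarrow> real ^ 'n \<Rightarrow> real ^ 'n" where
  "dual_act G \<phi> \<sigma> \<alpha> = adjoint (\<lambda>x. \<phi> (inv\<^bsub>G\<^esub> \<sigma>) *v x) \<alpha>"

definition fun_act ::
  "('g, 'm) monoid_scheme \<Rightarrow> ('g \<Rightarrow> real ^ 'n ^ 'n) \<Rightarrow> 'g \<Rightarrow>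
     (real ^ 'n \<Rightarrow> real) \<Rightarrow> real ^ 'n \<Rightarrow> real" where
  "fun_act G \<phi> \<sigma> f = (\<lambda>x. f (\<phi> (inv\<^bsub>G\<^esub> \<sigma>) *v x))"

definition orbit_reps ::
  "('g, 'm) monoid_scheme \<Rightarrow> ('g \<Rightarrow> 'a \<Rightarrow> 'a) \<Rightarrow> 'a set \<Rightarrow> 'a set \<Rightarrow> bool" where
  "orbit_reps G act S R \<longleftrightarrow>
     R \<subseteq> S \<and> (\<Union>x\<in>R. orbit G act x) = S \<and>
     (\<forall>T. T \<subset> R \<longrightarrow> (\<Union>x\<in>T. orbit G act x) \<noteq> S)"

text \<open>\<open>stab_orbits G act S \<beta>\<close> is \<open>S / Stab(\<beta>)\<close>. Its elements are the orbits themselves, so a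
  vector indexed by \<open>S / Stab(\<beta>)\<close> is a function on sets of exponents, and a summation
  index \<open>Orb\<close> plays the role of \<open>Stab(\<beta>) \<cdot> \<alpha>\<close>.\<close>

definition stab_orbits ::
  "('g, 'm) monoid_scheme \<Rightarrow> ('g \<Rightarrow> 'a \<Rightarrow> 'a) \<Rightarrow> 'a set \<Rightarrow> 'a \<Rightarrow> 'a set set" where
  "stab_orbits G act S \<beta> = orbits (G\<lparr>carrier := stabilizer G act \<beta>\<rparr>) S act"

definition C_AGE :: "(real ^ 'n) set \<Rightarrow> real ^ 'n \<Rightarrow> (real ^ 'n \<Rightarrow> real) set" where
  "C_AGE A \<beta> =
     {f. \<exists>c. (\<forall>\<alpha>\<in>A. 0 \<le> c \<alpha>) \<and>
             f = (\<lambda>x. (\<Sum>\<alpha>\<in>A. c \<alpha> * exp (\<alpha> \<bullet> x)) + c \<beta> * exp (\<beta> \<bullet> x)) \<and>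
             (\<forall>x. 0 \<le> f x)}"

text \<open>The sum adds sets of functions, so it is the Minkowski sum.\<close>

definition C_SAGE :: "(real ^ 'n) set \<Rightarrow> (real ^ 'n) set \<Rightarrow> (real ^ 'n \<Rightarrow> real) set" where
  "C_SAGE A B = (\<Sum>\<beta>\<in>B. C_AGE ((A \<union> B) - {\<beta>}) \<beta>)"

text \<open>\<open>y ln (y / z)\<close> for \<open>y, z \<ge> 0\<close>, with \<open>0 ln (0 / z) = 0\<close> and \<open>y ln (y / 0) = \<infinity>\<close> for \<open>y > 0\<close>.\<close>

definition rel_entropy :: "real \<Rightarrow> real \<Rightarrow> ereal" where
  "rel_entropy y z =
     (if y = 0 then 0 else if z = 0 then \<infinity> else ereal (y * ln (y / z)))"

end

theory Submission
  imports Defs "HOL-Real_Asymp.Real_Asymp"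
begin

text \<open>If \<open>f\<close> is a sum of AGE functions, elimination removes the other negative exponents from every
  summand, so that the summand of \<open>\<beta>\<close> is supported on \<open>A \<union> {\<beta>}\<close>. By relative entropy duality its
  nonnegativity is witnessed by a vector \<open>\<nu>\<close>. All coefficients and witnesses are then averaged over the
  diagonal action of \<open>G\<close> on pairs \<open>(\<beta>, \<alpha>)\<close>, which is possible since \<open>f\<close>, and by linear independence of
  the exponentials also its coefficients, are invariant. An invariant family is determined by its
  members for \<open>\<beta> \<in> B\<close> in a set of representatives, each of which is constant on the orbits of the
  stabiliser of \<open>\<beta>\<close>; conversely every such choice extends equivariantly. The weights in the last
  condition come from the orbit-stabiliser theorem.\<close>

subsection \<open>Exponential sums and relative entropy\<close>

text \<open>\<open>\<nu>\<close> is a dual variable: \<open>\<nu> ln (\<nu> / c) - \<nu>\<close> is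
  the convex conjugate of \<open>y \<mapsto> c exp y\<close>, and Euler's number in the theorem
  merely absorbs the term \<open>- \<nu>\<close>. The coefficients of a single summand may vanish
  even though those of f do not, so infinite entropies have to be tracked; they turn into the
  condition that \<open>\<nu>\<close> vanishes wherever c does. A single \<beta> is not fixed by G,
  which is why the families are averaged as functions of the pair (\<beta>, \<alpha>) and why only
  Stab(\<beta>)-invariance is left for each representative. The weights arise in two counts. A sum
  over B is the sum over the representatives \<beta> of a sum over G divided by |Stab(\<beta>)|.
  Invariance in the form C (g \<beta>) \<alpha> = C \<beta> (g^-1 \<alpha>) then moves the group
  element from \<beta> to \<alpha>, and as g runs through G each point of the orbit of \<alpha> is
  met |Stab(\<alpha>)| times.\<close>

lemma exp_inner_independent:
  fixes S :: "'a::real_inner set" and d :: "'a \<Rightarrow> real"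
  assumes "finite S" and eq0: "\<And>x. (\<Sum>\<alpha>\<in>S. d \<alpha> * exp (\<alpha> \<bullet> x)) = 0" and "\<alpha> \<in> S"
  shows "d \<alpha> = 0"
proof (rule ccontr)
  assume "d \<alpha> \<noteq> 0"
  define S' where "S' = {\<gamma>\<in>S. d \<gamma> \<noteq> 0}"
  have fin: "finite S'" and ne: "S' \<noteq> {}"
    using assms \<open>d \<alpha> \<noteq> 0\<close> by (auto simp: S'_def)
  \<comment> \<open>An exponent a of maximal norm dominates along its own ray: for another \<gamma>,
    expanding |\<gamma> - a|^2 > 0 with |\<gamma>| \<le> |a| gives \<gamma> \<bullet> a < a
    \<bullet> a. Rescaled by exp (- t (a \<bullet> a)), the vanishing sum at t a therefore tends to
    \<open>d a\<close>.\<close>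
  have "Max (norm ` S') \<in> norm ` S'" using fin ne by (intro Max_in) auto
  then obtain a where a: "a \<in> S'" and "norm a = Max (norm ` S')" by auto
  then have max: "norm \<gamma> \<le> norm a" if "\<gamma> \<in> S'" for \<gamma> using fin that by simp
  have zero: "(\<Sum>\<gamma>\<in>S'. d \<gamma> * exp (\<gamma> \<bullet> x)) = 0" for x
  proof -
    have "(\<Sum>\<gamma>\<in>S'. d \<gamma> * exp (\<gamma> \<bullet> x)) = (\<Sum>\<gamma>\<in>S. d \<gamma> * exp (\<gamma> \<bullet> x))"
      by (rule sum.mono_neutral_left) (use assms in \<open>auto simp: S'_def\<close>)
    then show ?thesis using eq0 by simp
  qed
  have "((\<lambda>t. \<Sum>\<gamma>\<in>S'. d \<gamma> * exp (t * (\<gamma> \<bullet> a - a \<bullet> a))) \<longlongrightarrow>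
         (\<Sum>\<gamma>\<in>S'. if \<gamma> = a then d a else 0)) at_top"
  proof (rule tendsto_sum)
    fix \<gamma> assume \<gamma>: "\<gamma> \<in> S'"
    show "((\<lambda>t. d \<gamma> * exp (t * (\<gamma> \<bullet> a - a \<bullet> a))) \<longlongrightarrow> (if \<gamma> = a then d a else 0)) at_top"
    proof (cases "\<gamma> = a")
      case False
      have "0 < (norm (\<gamma> - a))\<^sup>2" using False by simp
      moreover have "(norm \<gamma>)\<^sup>2 \<le> (norm a)\<^sup>2" using max[OF \<gamma>] by (simp add: power_mono)
      ultimately have "\<gamma> \<bullet> a - a \<bullet> a < 0"
        by (simp add: power2_norm_eq_inner inner_diff inner_commute)
      then have "((\<lambda>t. d \<gamma> * exp (t * (\<gamma> \<bullet> a - a \<bullet> a))) \<longlongrightarrow> 0) at_top"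
        by real_asymp
      then show ?thesis using False by simp
    qed simp
  qed
  moreover have "(\<Sum>\<gamma>\<in>S'. d \<gamma> * exp (t * (\<gamma> \<bullet> a - a \<bullet> a))) = 0" for t
  proof -
    have "(\<Sum>\<gamma>\<in>S'. d \<gamma> * exp (t * (\<gamma> \<bullet> a - a \<bullet> a))) =
          (\<Sum>\<gamma>\<in>S'. d \<gamma> * exp (\<gamma> \<bullet> (t *\<^sub>R a))) * exp (- t * (a \<bullet> a))"
      by (simp add: sum_distrib_right mult.assoc flip: exp_add) (simp add: algebra_simps)
    then show ?thesis unfolding zero by simp
  qed
  ultimately have "(\<Sum>\<gamma>\<in>S'. if \<gamma> = a then d a else 0) = 0"
    by (simp add: tendsto_const_iff)
  then show False using a fin by (simp add: S'_def)
qed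

lemma exp_inner_coeff_eq:
  fixes S :: "'a::real_inner set" and d d' :: "'a \<Rightarrow> real"
  assumes "finite S"
    and "\<And>x. (\<Sum>\<alpha>\<in>S. d \<alpha> * exp (\<alpha> \<bullet> x)) = (\<Sum>\<alpha>\<in>S. d' \<alpha> * exp (\<alpha> \<bullet> x))" and "\<alpha> \<in> S"
  shows "d \<alpha> = d' \<alpha>"
  using exp_inner_independent[of S "\<lambda>\<alpha>. d \<alpha> - d' \<alpha>" \<alpha>] assms
  by (simp add: left_diff_distrib sum_subtractf)

section \<open>Limits of weights, and duality between exponential sums and relative entropy\<close>

lemma bounded_family_subseq:
  fixes u :: "nat \<Rightarrow> 'i \<Rightarrow> real"
  assumes "finite I" and "\<And>i. i \<in> I \<Longrightarrow> bounded (range (\<lambda>n. u n i))"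
  shows "\<exists>l r. strict_mono (r :: nat \<Rightarrow> nat) \<and> (\<forall>i\<in>I. (\<lambda>n. u (r n) i) \<longlonglongrightarrow> l i)"
  using assms
proof (induction I)
  case empty
  then show ?case using strict_mono_id by (auto simp: strict_mono_def intro!: exI[of _ id])
next
  case (insert i I)
  then obtain l r where r: "strict_mono r" and l: "\<forall>j\<in>I. (\<lambda>n. u (r n) j) \<longlonglongrightarrow> l j"
    by auto
  have "bounded (range (\<lambda>n. u (r n) i))"
    by (rule bounded_subset[OF insert.prems[of i]]) auto
  then obtain m s where s: "strict_mono s" and m: "((\<lambda>n. u (r n) i) \<circ> s) \<longlonglongrightarrow> m"
    using bounded_imp_convergent_subsequence by blast
  have "(\<lambda>n. u (r (s n)) j) \<longlonglongrightarrow> l j" if "j \<in> I" for j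
    using LIMSEQ_subseq_LIMSEQ[OF l[rule_format, OF that] s] by (simp add: o_def)
  with m insert.hyps show ?case
    by (intro exI[of _ "l(i := m)"] exI[of _ "r \<circ> s"]) (auto simp: o_def strict_mono_o[OF r s, unfolded o_def])
qed

text \<open>At the limit 0 the logarithm is not continuous, but \<open>x * ln (x / c)\<close> is
  continuous from the right with value 0, and the sequence stays in the closed half line.\<close>

lemma tendsto_mult_ln_div:
  fixes t :: "nat \<Rightarrow> real"
  assumes lim: "t \<longlonglongrightarrow> l" and "\<And>n. 0 \<le> t n" and "0 < c"
  shows "(\<lambda>n. t n * ln (t n / c)) \<longlonglongrightarrow> l * ln (l / c)"
proof (cases "l = 0")
  case True
  have cont: "((\<lambda>x::real. x * ln (x / c)) \<longlongrightarrow> 0) (at_right 0)"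
    using \<open>0 < c\<close> by real_asymp
  have "((\<lambda>x::real. x * ln (x / c)) \<longlongrightarrow> 0) (at 0 within {0..})"
    using cont by (simp add: at_within_Ici_at_right)
  then have "continuous (at 0 within {0..}) (\<lambda>x::real. x * ln (x / c))"
    by (simp add: continuous_within)
  then show ?thesis
    using lim assms True unfolding continuous_within_sequentially by (auto simp: o_def)
next
  case False
  have "0 \<le> l" using LIMSEQ_le_const[OF lim, of 0] assms by auto
  with False assms show ?thesis by (intro tendsto_intros) auto
qed

text \<open>Minimisers \<open>x\<^sub>\<epsilon>\<close> of the exponential sum plus \<open>\<epsilon>\<bar>x\<bar>\<^sup>2\<close> exist even when the infimum of the sum is not
  attained. The weights \<open>c\<^sub>\<alpha> exp (p\<^sub>\<alpha> \<bullet> x\<^sub>\<epsilon>)\<close> balance up to \<open>2\<epsilon>x\<^sub>\<epsilon>\<close>, which vanishes as \<open>\<epsilon>\<close> tends to \<open>0\<close>, and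
  any limit point of them is the certificate.\<close>

lemma relative_entropy_duality:
  fixes p :: "'i \<Rightarrow> 'a::euclidean_space" and c :: "'i \<Rightarrow> real"
  assumes fin: "finite A" and c: "\<And>\<alpha>. \<alpha> \<in> A \<Longrightarrow> 0 \<le> c \<alpha>"
    and nonneg: "\<And>x. 0 \<le> (\<Sum>\<alpha>\<in>A. c \<alpha> * exp (p \<alpha> \<bullet> x)) + b"
  shows "\<exists>\<nu>. (\<forall>\<alpha>\<in>A. 0 \<le> \<nu> \<alpha> \<and> (c \<alpha> = 0 \<longrightarrow> \<nu> \<alpha> = 0)) \<and>
             (\<Sum>\<alpha>\<in>A. \<nu> \<alpha> *\<^sub>R p \<alpha>) = 0 \<and> (\<Sum>\<alpha>\<in>A. \<nu> \<alpha> * ln (\<nu> \<alpha> / c \<alpha>) - \<nu> \<alpha>) \<le> b"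
proof -
  define h where "h = (\<lambda>x. \<Sum>\<alpha>\<in>A. c \<alpha> * exp (p \<alpha> \<bullet> x))"
  define e where "e = (\<lambda>n. inverse (real (Suc n)))"
  have e_pos: "0 < e n" for n by (simp add: e_def)
  have h_nonneg: "0 \<le> h x" for x unfolding h_def by (intro sum_nonneg mult_nonneg_nonneg c) auto
  define K where "K = h 0"
  have K: "0 \<le> K" using h_nonneg K_def by simp
  have "\<exists>x. \<forall>y. h x + e n * (norm x)\<^sup>2 \<le> h y + e n * (norm y)\<^sup>2" for n
  proof -
    \<comment> \<open>Outside the ball of this radius the penalty alone is at least K, the value at
      0, so a minimiser on the ball is a global one.\<close>
    define R where "R = sqrt (K / e n)"
    have "R \<ge> 0" using K e_pos[of n] by (simp add: R_def)
    have "continuous_on (cball 0 R) (\<lambda>x. h x + e n * (norm x)\<^sup>2)"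
      unfolding h_def by (intro continuous_intros)
    then obtain x where x: "x \<in> cball 0 R"
      and min: "\<And>y. y \<in> cball 0 R \<Longrightarrow> h x + e n * (norm x)\<^sup>2 \<le> h y + e n * (norm y)\<^sup>2"
      using continuous_attains_inf[of "cball 0 R" "\<lambda>x. h x + e n * (norm x)\<^sup>2"] \<open>R \<ge> 0\<close>
      by auto
    have "h x + e n * (norm x)\<^sup>2 \<le> h y + e n * (norm y)\<^sup>2" for y
    proof (cases "norm y \<le> R")
      case False
      then have "R\<^sup>2 \<le> (norm y)\<^sup>2" using \<open>R \<ge> 0\<close> by (intro power_mono) auto
      then have "K \<le> e n * (norm y)\<^sup>2"
        using K e_pos[of n] by (simp add: R_def field_simps)
      moreover have "h x + e n * (norm x)\<^sup>2 \<le> K"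
        using min[of 0] \<open>R \<ge> 0\<close> by (simp add: K_def)
      ultimately show ?thesis using h_nonneg[of y] by linarith
    qed (use min in auto)
    then show ?thesis by blast
  qed
  then obtain x where x: "\<And>n y. h (x n) + e n * (norm (x n))\<^sup>2 \<le> h y + e n * (norm y)\<^sup>2"
    by metis
  define u where "u = (\<lambda>n \<alpha>. c \<alpha> * exp (p \<alpha> \<bullet> x n))"
  have u_nonneg: "\<alpha> \<in> A \<Longrightarrow> 0 \<le> u n \<alpha>" for n \<alpha> by (simp add: u_def c)
  have sum_u: "(\<Sum>\<alpha>\<in>A. u n \<alpha>) = h (x n)" for n by (simp add: u_def h_def)
  have x_K: "h (x n) + e n * (norm (x n))\<^sup>2 \<le> K" for n using x[of n 0] by (simp add: K_def)
  have u_K: "u n \<alpha> \<le> K" if "\<alpha> \<in> A" for n \<alpha>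
  proof -
    have "u n \<alpha> \<le> h (x n)"
      unfolding sum_u[symmetric] using fin that u_nonneg by (intro member_le_sum) auto
    also have "\<dots> \<le> K"
      using x_K[of n] e_pos[of n] by (smt (verit) mult_nonneg_nonneg zero_le_power2)
    finally show ?thesis .
  qed
  have grad: "(\<Sum>\<alpha>\<in>A. u n \<alpha> *\<^sub>R p \<alpha>) = - ((2 * e n) *\<^sub>R x n)" for n
  proof -
    \<comment> \<open>v is the gradient of the penalised sum at its minimiser \<open>x n\<close>.
      The derivative in the direction v itself is \<open>v \<bullet> v\<close>, which must
      vanish.\<close>
    define v where "v = (\<Sum>\<alpha>\<in>A. u n \<alpha> *\<^sub>R p \<alpha>) + (2 * e n) *\<^sub>R x n"
    define F where "F = (\<lambda>t. h (x n + t *\<^sub>R v) + e n * (norm (x n + t *\<^sub>R v))\<^sup>2)"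
    have F_eq: "F = (\<lambda>t. (\<Sum>\<alpha>\<in>A. c \<alpha> * exp (p \<alpha> \<bullet> x n + t * (p \<alpha> \<bullet> v))) +
        e n * (x n \<bullet> x n + 2 * t * (x n \<bullet> v) + t\<^sup>2 * (v \<bullet> v)))"
      unfolding F_def h_def power2_norm_eq_inner
      by (simp add: inner_add_left inner_add_right inner_commute power2_eq_square algebra_simps)
    have "(F has_real_derivative
        (\<Sum>\<alpha>\<in>A. c \<alpha> * (exp (p \<alpha> \<bullet> x n) * (p \<alpha> \<bullet> v))) + e n * (2 * (x n \<bullet> v))) (at 0)"
      unfolding F_eq by (auto intro!: derivative_eq_intros simp: mult_ac)
    then have "(\<Sum>\<alpha>\<in>A. c \<alpha> * (exp (p \<alpha> \<bullet> x n) * (p \<alpha> \<bullet> v))) + e n * (2 * (x n \<bullet> v)) = 0"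
      by (rule DERIV_local_min[of _ _ _ 1]) (use x in \<open>simp_all add: F_def\<close>)
    moreover have "v \<bullet> w = (\<Sum>\<alpha>\<in>A. c \<alpha> * (exp (p \<alpha> \<bullet> x n) * (p \<alpha> \<bullet> w))) + e n * (2 * (x n \<bullet> w))" for w
      by (simp add: v_def u_def inner_add_left inner_sum_left mult_ac)
    ultimately have "v = 0" by (metis inner_eq_zero_iff)
    then show ?thesis by (simp add: v_def add_eq_0_iff2)
  qed
  have ent: "(\<Sum>\<alpha>\<in>A. u n \<alpha> * ln (u n \<alpha> / c \<alpha>) - u n \<alpha>) \<le> b" for n
  proof -
    \<comment> \<open>The logarithm equals \<open>p \<alpha> \<bullet> x n\<close> if
      \<open>c \<alpha> > 0\<close>, and otherwise its factor \<open>u n \<alpha>\<close> is 0. By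
      \<open>grad\<close> the penalty contributes a term of the favourable sign, so the entropy
      bound holds before the limit is taken.\<close>
    have "(\<Sum>\<alpha>\<in>A. u n \<alpha> * ln (u n \<alpha> / c \<alpha>) - u n \<alpha>) = (\<Sum>\<alpha>\<in>A. u n \<alpha> *\<^sub>R p \<alpha>) \<bullet> x n - h (x n)"
      unfolding sum_subtractf sum_u inner_sum_left
      by (intro arg_cong2[where f = "(-)"] sum.cong) (auto simp: u_def)
    also have "\<dots> = - (2 * e n * (norm (x n))\<^sup>2) - h (x n)"
      by (simp add: grad power2_norm_eq_inner)
    also have "\<dots> \<le> - h (x n)" using e_pos[of n] by simp
    also have "\<dots> \<le> b" using nonneg[of "x n"] by (simp add: h_def)
    finally show ?thesis .
  qed
  have "bounded (range (\<lambda>n. u n \<alpha>))" if "\<alpha> \<in> A" for \<alpha>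
    by (rule boundedI[of _ K]) (use u_nonneg[OF that] u_K[OF that] in auto)
  then obtain \<nu> r where r: "strict_mono (r :: nat \<Rightarrow> nat)"
    and \<nu>: "\<And>\<alpha>. \<alpha> \<in> A \<Longrightarrow> (\<lambda>n. u (r n) \<alpha>) \<longlonglongrightarrow> \<nu> \<alpha>"
    using bounded_family_subseq[OF fin, of u] by auto
  have e_lim: "(\<lambda>n. e (r n)) \<longlonglongrightarrow> 0"
    using LIMSEQ_subseq_LIMSEQ[OF LIMSEQ_inverse_real_of_nat r] by (simp add: e_def o_def)
  \<comment> \<open>The minimisers may be unbounded. Comparison with the origin bounds only
    \<open>e n * (norm (x n))^2\<close> by K, which makes the defect in the balance of order sqrt (e
    n).\<close>
  have "(\<lambda>n. (2 * e (r n)) *\<^sub>R x (r n)) \<longlonglongrightarrow> 0"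
  proof (rule Lim_null_comparison)
    show "(\<lambda>n. sqrt (4 * e (r n) * K)) \<longlonglongrightarrow> 0"
      using tendsto_real_sqrt[OF tendsto_mult[OF tendsto_mult[OF tendsto_const[of 4] e_lim] tendsto_const[of K]]]
      by simp
    have "norm ((2 * e n) *\<^sub>R x n) \<le> sqrt (4 * e n * K)" for n
    proof (rule real_le_rsqrt)
      have "e n * (norm (x n))\<^sup>2 \<le> K" using x_K[of n] h_nonneg[of "x n"] by linarith
      then have "4 * e n * (e n * (norm (x n))\<^sup>2) \<le> 4 * e n * K"
        using e_pos[of n] by simp
      then show "(norm ((2 * e n) *\<^sub>R x n))\<^sup>2 \<le> 4 * e n * K"
        by (simp add: power_mult_distrib power2_eq_square mult_ac)
    qed
    then show "\<forall>\<^sub>F n in sequentially. norm ((2 * e (r n)) *\<^sub>R x (r n)) \<le> sqrt (4 * e (r n) * K)"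
      by simp
  qed
  from tendsto_minus[OF this]
  have "(\<lambda>n. \<Sum>\<alpha>\<in>A. u (r n) \<alpha> *\<^sub>R p \<alpha>) \<longlonglongrightarrow> 0"
    by (simp add: grad)
  moreover have "(\<lambda>n. \<Sum>\<alpha>\<in>A. u (r n) \<alpha> *\<^sub>R p \<alpha>) \<longlonglongrightarrow> (\<Sum>\<alpha>\<in>A. \<nu> \<alpha> *\<^sub>R p \<alpha>)"
    by (intro tendsto_intros \<nu>)
  ultimately have balance: "(\<Sum>\<alpha>\<in>A. \<nu> \<alpha> *\<^sub>R p \<alpha>) = 0" by (rule LIMSEQ_unique[symmetric])
  have \<nu>_nonneg: "0 \<le> \<nu> \<alpha>" if "\<alpha> \<in> A" for \<alpha>
    using LIMSEQ_le_const[OF \<nu>[OF that], of 0] u_nonneg[OF that] by auto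
  \<comment> \<open>The entropy bound does not imply this, since \<open>\<nu> \<alpha> / 0\<close>
    is 0 in the reals; it is inherited from the approximating weights, all of which vanish
    here.\<close>
  have \<nu>_zero: "\<nu> \<alpha> = 0" if "\<alpha> \<in> A" "c \<alpha> = 0" for \<alpha>
    using \<nu>[OF that(1)] that(2) by (simp add: u_def LIMSEQ_const_iff)
  have "(\<lambda>n. \<Sum>\<alpha>\<in>A. u (r n) \<alpha> * ln (u (r n) \<alpha> / c \<alpha>) - u (r n) \<alpha>) \<longlonglongrightarrow>
        (\<Sum>\<alpha>\<in>A. \<nu> \<alpha> * ln (\<nu> \<alpha> / c \<alpha>) - \<nu> \<alpha>)"
  proof (intro tendsto_sum tendsto_diff \<nu>)
    fix \<alpha> assume \<alpha>: "\<alpha> \<in> A"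
    show "(\<lambda>n. u (r n) \<alpha> * ln (u (r n) \<alpha> / c \<alpha>)) \<longlonglongrightarrow> \<nu> \<alpha> * ln (\<nu> \<alpha> / c \<alpha>)"
    proof (cases "c \<alpha> = 0")
      case True
      then show ?thesis using \<nu>_zero[OF \<alpha>] by (simp add: u_def)
    next
      case False
      then show ?thesis using c[OF \<alpha>] u_nonneg[OF \<alpha>] by (intro tendsto_mult_ln_div \<nu> \<alpha>) auto
    qed
  qed
  then have "(\<Sum>\<alpha>\<in>A. \<nu> \<alpha> * ln (\<nu> \<alpha> / c \<alpha>) - \<nu> \<alpha>) \<le> b"
    using ent by (intro LIMSEQ_le_const2) auto
  then show ?thesis using balance \<nu>_nonneg \<nu>_zero by blast
qed

text \<open>Fenchel-Young in every term: exp z \<ge> 1 + z at \<open>z = p \<alpha> \<bullet> x - ln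
  (\<nu> \<alpha> / c \<alpha>)\<close>, multiplied by \<open>\<nu> \<alpha>\<close>, bounds the
  exponential term below by an affine function of x. The linear parts cancel by
  \<open>balance\<close>.\<close>

lemma relative_entropy_weak_duality:
  fixes p :: "'i \<Rightarrow> 'a::real_inner" and c \<nu> :: "'i \<Rightarrow> real"
  assumes c: "\<And>\<alpha>. \<alpha> \<in> A \<Longrightarrow> 0 \<le> c \<alpha>" and \<nu>: "\<And>\<alpha>. \<alpha> \<in> A \<Longrightarrow> 0 \<le> \<nu> \<alpha>"
    and supp: "\<And>\<alpha>. \<alpha> \<in> A \<Longrightarrow> c \<alpha> = 0 \<Longrightarrow> \<nu> \<alpha> = 0"
    and balance: "(\<Sum>\<alpha>\<in>A. \<nu> \<alpha> *\<^sub>R p \<alpha>) = 0"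
    and ent: "(\<Sum>\<alpha>\<in>A. \<nu> \<alpha> * ln (\<nu> \<alpha> / c \<alpha>) - \<nu> \<alpha>) \<le> b"
  shows "0 \<le> (\<Sum>\<alpha>\<in>A. c \<alpha> * exp (p \<alpha> \<bullet> x)) + b"
proof -
  have "\<nu> \<alpha> * (p \<alpha> \<bullet> x) - (\<nu> \<alpha> * ln (\<nu> \<alpha> / c \<alpha>) - \<nu> \<alpha>) \<le> c \<alpha> * exp (p \<alpha> \<bullet> x)" if "\<alpha> \<in> A" for \<alpha>
  proof (cases "\<nu> \<alpha> = 0")
    case False
    then have pos: "0 < \<nu> \<alpha>" "0 < c \<alpha>"
      using c[OF that] \<nu>[OF that] supp[OF that] by force+
    have "c \<alpha> * exp (p \<alpha> \<bullet> x) = \<nu> \<alpha> * exp (p \<alpha> \<bullet> x - ln (\<nu> \<alpha> / c \<alpha>))"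
      using pos by (simp add: exp_diff)
    also have "\<dots> \<ge> \<nu> \<alpha> * (1 + (p \<alpha> \<bullet> x - ln (\<nu> \<alpha> / c \<alpha>)))"
      using pos exp_ge_add_one_self by (intro mult_left_mono) auto
    finally show ?thesis by (simp add: algebra_simps)
  qed (use c[OF that] in simp)
  then have "(\<Sum>\<alpha>\<in>A. \<nu> \<alpha> *\<^sub>R p \<alpha>) \<bullet> x - (\<Sum>\<alpha>\<in>A. \<nu> \<alpha> * ln (\<nu> \<alpha> / c \<alpha>) - \<nu> \<alpha>) \<le>
      (\<Sum>\<alpha>\<in>A. c \<alpha> * exp (p \<alpha> \<bullet> x))"
    unfolding inner_sum_left sum_subtractf[symmetric] by (intro sum_mono) simp
  then show ?thesis using balance ent by simp
qed

section \<open>Convexity of relative entropy, and its infinite values\<close>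

lemma log_sum_inequality:
  fixes t c :: "'i \<Rightarrow> real"
  assumes "finite I" and t: "\<And>i. i \<in> I \<Longrightarrow> 0 \<le> t i" and c: "\<And>i. i \<in> I \<Longrightarrow> 0 \<le> c i"
    and supp: "\<And>i. i \<in> I \<Longrightarrow> c i = 0 \<Longrightarrow> t i = 0"
  shows "sum t I * ln (sum t I / sum c I) \<le> (\<Sum>i\<in>I. t i * ln (t i / c i))"
proof (cases "sum t I = 0")
  case True
  then have "\<forall>i\<in>I. t i = 0" using assms by (simp add: sum_nonneg_eq_0_iff)
  then show ?thesis using True by simp
next
  case False
  then obtain j where "j \<in> I" "t j \<noteq> 0" by (meson sum.neutral)
  then have "c j \<noteq> 0" using supp by blast
  have s: "0 < sum t I" using False t by (simp add: less_le sum_nonneg)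
  have d: "0 < sum c I"
    using \<open>j \<in> I\<close> \<open>c j \<noteq> 0\<close> assms by (smt (verit) sum_nonneg sum_nonneg_eq_0_iff)
  \<comment> \<open>The bound ln z \<le> z - 1 is applied with \<open>z = q * c i / t i\<close>. For
    this value of q the errors \<open>q * c i - t i\<close> add up to 0 over I.\<close>
  define q where "q = sum t I / sum c I"
  have q: "0 < q" using s d by (simp add: q_def)
  have "t i * ln q - (q * c i - t i) \<le> t i * ln (t i / c i)" if "i \<in> I" for i
  proof (cases "t i = 0")
    case False
    then have pos: "0 < t i" "0 < c i" using t[OF that] c[OF that] supp[OF that] by force+
    have "ln (q * c i / t i) \<le> q * c i / t i - 1"
      using pos q by (intro ln_le_minus_one) auto
    then have "t i * ln (q * c i / t i) \<le> q * c i - t i"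
      using pos by (simp add: field_simps)
    moreover have "ln (q * c i / t i) = ln q - ln (t i / c i)"
      using pos q by (simp add: ln_div ln_mult)
    ultimately show ?thesis by (simp add: right_diff_distrib)
  qed (use c[OF that] q in simp)
  then have "(\<Sum>i\<in>I. t i * ln q - (q * c i - t i)) \<le> (\<Sum>i\<in>I. t i * ln (t i / c i))"
    by (rule sum_mono)
  moreover have "(\<Sum>i\<in>I. t i * ln q - (q * c i - t i)) = sum t I * ln q - (q * sum c I - sum t I)"
    by (simp add: sum_subtractf sum_distrib_left sum_distrib_right)
  moreover have "q * sum c I = sum t I" using d by (simp add: q_def)
  ultimately show ?thesis by (simp add: q_def)
qed

text \<open>Passage from extended to ordinary reals. The factor \<open>exp 1\<close> under the
  logarithm produces \<open>- t i\<close>. As the weights are strictly positive, one infinite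
  entropy makes the whole sum infinite, so finiteness amounts to the support condition.\<close>

lemma sum_rel_entropy_le_iff:
  assumes "finite I" and w: "\<And>i. i \<in> I \<Longrightarrow> 0 < w i"
    and t: "\<And>i. i \<in> I \<Longrightarrow> 0 \<le> t i" and z: "\<And>i. i \<in> I \<Longrightarrow> 0 \<le> z i"
  shows "(\<Sum>i\<in>I. ereal (w i) * rel_entropy (t i) (exp 1 * z i)) \<le> ereal b \<longleftrightarrow>
    (\<forall>i\<in>I. z i = 0 \<longrightarrow> t i = 0) \<and> (\<Sum>i\<in>I. w i * (t i * ln (t i / z i) - t i)) \<le> b"
proof (cases "\<forall>i\<in>I. z i = 0 \<longrightarrow> t i = 0")
  case True
  have "ereal (w i) * rel_entropy (t i) (exp 1 * z i) = ereal (w i * (t i * ln (t i / z i) - t i))"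
    if "i \<in> I" for i
  proof (cases "t i = 0")
    case False
    then have "0 < t i" "0 < z i" using True t[OF that] z[OF that] that by force+
    then show ?thesis by (simp add: rel_entropy_def ln_div ln_mult algebra_simps)
  qed (simp add: rel_entropy_def flip: zero_ereal_def)
  then show ?thesis using True by simp
next
  case False
  then obtain i where i: "i \<in> I" "z i = 0" "t i \<noteq> 0" by blast
  have "(\<Sum>i\<in>I. ereal (w i) * rel_entropy (t i) (exp 1 * z i)) = \<infinity>"
    unfolding sum_Pinfty using i w[OF i(1)] \<open>finite I\<close> by (auto simp: rel_entropy_def intro!: bexI[of _ i])
  then show ?thesis using False by simp
qed

subsection \<open>Signed SAGE cones\<close>

text \<open>Division by 0 yields 0 in the reals, so the entropy term stays finite at
  \<open>c \<alpha> = 0\<close>; the clause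
  \<open>c \<alpha> = 0 \<longrightarrow> \<nu> \<alpha> = 0\<close> replaces the value infinity of
  the convention.\<close>

definition age_certificate ::
  "'a::real_inner set \<Rightarrow> 'a \<Rightarrow> real \<Rightarrow> ('a \<Rightarrow> real) \<Rightarrow> ('a \<Rightarrow> real) \<Rightarrow> bool" where
  "age_certificate A \<beta> b c \<nu> \<longleftrightarrow>
     (\<forall>\<alpha>\<in>A. 0 \<le> c \<alpha> \<and> 0 \<le> \<nu> \<alpha> \<and> (c \<alpha> = 0 \<longrightarrow> \<nu> \<alpha> = 0)) \<and>
     (\<Sum>\<alpha>\<in>A. \<nu> \<alpha> *\<^sub>R (\<alpha> - \<beta>)) = 0 \<and>
     (\<Sum>\<alpha>\<in>A. \<nu> \<alpha> * ln (\<nu> \<alpha> / c \<alpha>) - \<nu> \<alpha>) \<le> b"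

text \<open>Division by \<open>exp (\<beta> \<bullet> x)\<close> keeps the sign and shifts the
  exponents to \<open>\<alpha> - \<beta>\<close>, so the term of \<beta> becomes the constant b of
  the two duality lemmas.\<close>

lemma age_nonneg_iff:
  fixes A :: "'a::euclidean_space set"
  assumes "finite A"
  shows "(\<forall>\<alpha>\<in>A. 0 \<le> c \<alpha>) \<and> (\<forall>x. 0 \<le> (\<Sum>\<alpha>\<in>A. c \<alpha> * exp (\<alpha> \<bullet> x)) + b * exp (\<beta> \<bullet> x)) \<longleftrightarrow>
    (\<exists>\<nu>. age_certificate A \<beta> b c \<nu>)"
proof -
  have "(\<Sum>\<alpha>\<in>A. c \<alpha> * exp (\<alpha> \<bullet> x)) + b * exp (\<beta> \<bullet> x) =
      exp (\<beta> \<bullet> x) * ((\<Sum>\<alpha>\<in>A. c \<alpha> * exp ((\<alpha> - \<beta>) \<bullet> x)) + b)" for x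
    by (simp add: inner_diff_left exp_diff distrib_left sum_distrib_left)
  then have "0 \<le> (\<Sum>\<alpha>\<in>A. c \<alpha> * exp (\<alpha> \<bullet> x)) + b * exp (\<beta> \<bullet> x) \<longleftrightarrow>
      0 \<le> (\<Sum>\<alpha>\<in>A. c \<alpha> * exp ((\<alpha> - \<beta>) \<bullet> x)) + b" for x
    by (simp add: zero_le_mult_iff)
  moreover have "(\<forall>\<alpha>\<in>A. 0 \<le> c \<alpha>) \<and> (\<forall>x. 0 \<le> (\<Sum>\<alpha>\<in>A. c \<alpha> * exp ((\<alpha> - \<beta>) \<bullet> x)) + b) \<longleftrightarrow>
      (\<exists>\<nu>. age_certificate A \<beta> b c \<nu>)"
  proof
    assume "(\<forall>\<alpha>\<in>A. 0 \<le> c \<alpha>) \<and> (\<forall>x. 0 \<le> (\<Sum>\<alpha>\<in>A. c \<alpha> * exp ((\<alpha> - \<beta>) \<bullet> x)) + b)"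
    with relative_entropy_duality[OF assms, of c "\<lambda>\<alpha>. \<alpha> - \<beta>" b]
    show "\<exists>\<nu>. age_certificate A \<beta> b c \<nu>" unfolding age_certificate_def by blast
  next
    assume "\<exists>\<nu>. age_certificate A \<beta> b c \<nu>"
    then show "(\<forall>\<alpha>\<in>A. 0 \<le> c \<alpha>) \<and> (\<forall>x. 0 \<le> (\<Sum>\<alpha>\<in>A. c \<alpha> * exp ((\<alpha> - \<beta>) \<bullet> x)) + b)"
      using relative_entropy_weak_duality[of A c _ "\<lambda>\<alpha>. \<alpha> - \<beta>" b]
      unfolding age_certificate_def by blast
  qed
  ultimately show ?thesis by simp
qed

text \<open>Gaussian elimination: the summand with the negative coefficient at \<open>t\<close> is redistributed to the other
  summands so as to cancel their nonnegative coefficients at \<open>t\<close>. As \<open>c t < 0\<close>, the share that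
  remains is nonnegative.\<close>

lemma eliminate_negative_exponents:
  fixes C :: "'a::real_inner \<Rightarrow> 'a \<Rightarrow> real"
  assumes "finite E" and "finite B" and "B \<subseteq> E"
    and off: "\<forall>\<beta>\<in>B. \<forall>\<gamma>\<in>E. \<gamma> \<noteq> \<beta> \<longrightarrow> 0 \<le> C \<beta> \<gamma>"
    and nonneg: "\<forall>\<beta>\<in>B. \<forall>x. 0 \<le> (\<Sum>\<gamma>\<in>E. C \<beta> \<gamma> * exp (\<gamma> \<bullet> x))"
    and total: "\<forall>\<gamma>\<in>E. (\<Sum>\<beta>\<in>B. C \<beta> \<gamma>) = c \<gamma>"
    and neg: "\<forall>\<beta>\<in>B. c \<beta> < 0"
    and "finite T" and "T \<subseteq> B"
  shows "\<exists>D. (\<forall>\<beta>\<in>B. \<forall>\<gamma>\<in>E. \<gamma> \<noteq> \<beta> \<longrightarrow> 0 \<le> D \<beta> \<gamma>) \<and>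
      (\<forall>\<beta>\<in>B. \<forall>x. 0 \<le> (\<Sum>\<gamma>\<in>E. D \<beta> \<gamma> * exp (\<gamma> \<bullet> x))) \<and>
      (\<forall>\<gamma>\<in>E. (\<Sum>\<beta>\<in>B. D \<beta> \<gamma>) = c \<gamma>) \<and>
      (\<forall>\<gamma>\<in>T. \<forall>\<beta>\<in>B. \<beta> \<noteq> \<gamma> \<longrightarrow> D \<beta> \<gamma> = 0)"
  using \<open>finite T\<close> \<open>T \<subseteq> B\<close>
proof (induction T)
  case empty
  show ?case using off nonneg total by (intro exI[of _ C]) auto
next
  case (insert t T)
  then have "T \<subseteq> B" by simp
  from insert.IH[OF this] obtain D where D: "\<forall>\<beta>\<in>B. \<forall>\<gamma>\<in>E. \<gamma> \<noteq> \<beta> \<longrightarrow> 0 \<le> D \<beta> \<gamma>"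
      "\<forall>\<beta>\<in>B. \<forall>x. 0 \<le> (\<Sum>\<gamma>\<in>E. D \<beta> \<gamma> * exp (\<gamma> \<bullet> x))"
    and D_total: "\<forall>\<gamma>\<in>E. (\<Sum>\<beta>\<in>B. D \<beta> \<gamma>) = c \<gamma>"
    and D_zero: "\<forall>\<gamma>\<in>T. \<forall>\<beta>\<in>B. \<beta> \<noteq> \<gamma> \<longrightarrow> D \<beta> \<gamma> = 0"
    by (elim exE conjE) (rule that)
  have D_off: "0 \<le> D \<beta> \<gamma>" if "\<beta> \<in> B" "\<gamma> \<in> E" "\<gamma> \<noteq> \<beta>" for \<beta> \<gamma>
    using D(1) that by simp
  have D_nonneg: "0 \<le> (\<Sum>\<gamma>\<in>E. D \<beta> \<gamma> * exp (\<gamma> \<bullet> x))" if "\<beta> \<in> B" for \<beta> x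
    using D(2) that by simp
  have t: "t \<in> B" "t \<in> E" using insert.prems \<open>B \<subseteq> E\<close> by auto
  have split: "(\<Sum>\<beta>\<in>B. D \<beta> t) = D t t + (\<Sum>\<beta>\<in>B - {t}. D \<beta> t)"
    using t \<open>finite B\<close> by (simp add: sum.remove)
  moreover have rest: "0 \<le> (\<Sum>\<beta>\<in>B - {t}. D \<beta> t)" using D_off t by (intro sum_nonneg) auto
  ultimately have Dtt: "D t t < 0" using bspec[OF D_total t(2)] bspec[OF neg t(1)] by simp
  \<comment> \<open>The multiple of row t added to row \<beta>. For \<beta> other than t it cancels
    the entry in column t; for t itself it rescales the row so that its entry in column t becomes
    \<open>c t\<close>. The multiples add up to 0, so all column totals are kept.\<close>
  define l where "l = (\<lambda>\<beta>. if \<beta> = t then c t / D t t - 1 else D \<beta> t / - D t t)"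
  define D' where "D' = (\<lambda>\<beta> \<gamma>. D \<beta> \<gamma> + l \<beta> * D t \<gamma>)"
  have l_nonneg: "0 \<le> l \<beta>" if "\<beta> \<in> B" "\<beta> \<noteq> t" for \<beta>
    using that D_off[of \<beta> t] t Dtt by (simp add: l_def divide_nonneg_neg)
  have D't: "D' t \<gamma> = c t / D t t * D t \<gamma>" for \<gamma>
    by (simp add: D'_def l_def left_diff_distrib)
  have ratio: "0 \<le> c t / D t t" using Dtt bspec[OF neg t(1)] by (simp add: divide_nonpos_neg)
  have "(\<Sum>\<beta>\<in>B. l \<beta>) = l t + (\<Sum>\<beta>\<in>B - {t}. l \<beta>)"
    using t \<open>finite B\<close> by (simp add: sum.remove)
  also have "(\<Sum>\<beta>\<in>B - {t}. l \<beta>) = (\<Sum>\<beta>\<in>B - {t}. D \<beta> t) / - D t t"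
    unfolding sum_divide_distrib by (intro sum.cong) (auto simp: l_def)
  also have "(\<Sum>\<beta>\<in>B - {t}. D \<beta> t) = c t - D t t" using split bspec[OF D_total t(2)] by simp
  finally have l_sum: "(\<Sum>\<beta>\<in>B. l \<beta>) = 0" using Dtt by (simp add: l_def field_simps)
  have off': "0 \<le> D' \<beta> \<gamma>" if "\<beta> \<in> B" "\<gamma> \<in> E" "\<gamma> \<noteq> \<beta>" for \<beta> \<gamma>
  proof -
    consider "\<beta> = t" | "\<beta> \<noteq> t" "\<gamma> = t" | "\<beta> \<noteq> t" "\<gamma> \<noteq> t" by blast
    then show ?thesis
    proof cases
      case 1
      then show ?thesis unfolding 1 D't using ratio D_off[of t \<gamma>] that t(1) 1
        by (intro mult_nonneg_nonneg) simp_all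
    next
      case 2
      then show ?thesis using Dtt by (simp add: D'_def l_def)
    next
      case 3
      then show ?thesis using l_nonneg[of \<beta>] D_off[of \<beta> \<gamma>] D_off[of t \<gamma>] that t
        by (simp add: D'_def)
    qed
  qed
  have nonneg': "0 \<le> (\<Sum>\<gamma>\<in>E. D' \<beta> \<gamma> * exp (\<gamma> \<bullet> x))" if "\<beta> \<in> B" for \<beta> x
  proof (cases "\<beta> = t")
    case True
    have "(\<Sum>\<gamma>\<in>E. D' \<beta> \<gamma> * exp (\<gamma> \<bullet> x)) = c t / D t t * (\<Sum>\<gamma>\<in>E. D t \<gamma> * exp (\<gamma> \<bullet> x))"
      by (simp add: True D't sum_distrib_left mult.assoc)
    then show ?thesis using ratio D_nonneg[OF t(1)] by (simp only: mult_nonneg_nonneg)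
  next
    case False
    have "(\<Sum>\<gamma>\<in>E. D' \<beta> \<gamma> * exp (\<gamma> \<bullet> x)) =
        (\<Sum>\<gamma>\<in>E. D \<beta> \<gamma> * exp (\<gamma> \<bullet> x)) + l \<beta> * (\<Sum>\<gamma>\<in>E. D t \<gamma> * exp (\<gamma> \<bullet> x))"
      by (simp add: D'_def sum_distrib_left distrib_right sum.distrib mult.assoc)
    then show ?thesis
      using D_nonneg[OF that, of x] D_nonneg[OF t(1), of x] l_nonneg[OF that False] by simp
  qed
  have total': "(\<Sum>\<beta>\<in>B. D' \<beta> \<gamma>) = c \<gamma>" if "\<gamma> \<in> E" for \<gamma>
    using bspec[OF D_total that] l_sum by (simp add: D'_def sum.distrib flip: sum_distrib_right)
  have zero': "D' \<beta> \<gamma> = 0" if "\<gamma> \<in> insert t T" "\<beta> \<in> B" "\<beta> \<noteq> \<gamma>" for \<gamma> \<beta>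
  proof (cases "\<gamma> = t")
    case True
    then show ?thesis using that Dtt by (simp add: D'_def l_def)
  next
    \<comment> \<open>Columns cleared earlier are not refilled: t differs from \<gamma>, so row t
      already has a zero in column \<gamma>.\<close>
    case False
    then show ?thesis using that D_zero t by (simp add: D'_def)
  qed
  show ?case
    by (intro exI[of _ D'] conjI ballI allI impI off' nonneg' total' zero')
qed

lemma C_SAGE_alt:
  assumes "finite B"
  shows "C_SAGE A B = {(\<lambda>x. \<Sum>\<beta>\<in>B. g \<beta> x) | g. \<forall>\<beta>\<in>B. g \<beta> \<in> C_AGE ((A \<union> B) - {\<beta>}) \<beta>}"
proof -
  have "sum g B = (\<lambda>x. \<Sum>\<beta>\<in>B. g \<beta> x)" for g :: "real ^ 'a \<Rightarrow> real ^ 'a \<Rightarrow> real"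
    using assms by (induction B) (auto simp: fun_eq_iff)
  then show ?thesis by (simp add: C_SAGE_def set_sum_alt[OF assms])
qed

text \<open>After elimination only the diagonal entry is left in a column \<beta> of B, so it equals
  \<open>c \<beta>\<close>. Conversely, the slack
  \<open>c \<alpha> - (\<Sum>\<beta>\<in>B. C \<beta> \<alpha>)\<close> can be given to one
  arbitrary summand, because larger coefficients on A keep it nonnegative; this is why the totals
  satisfy an inequality and not an equation.\<close>

lemma C_SAGE_iff_age_certificate:
  fixes A B :: "(real ^ 'n) set"
  assumes finA: "finite A" and finB: "finite B" and "B \<noteq> {}" and disj: "A \<inter> B = {}"
    and neg: "\<forall>\<beta>\<in>B. c \<beta> < 0"
    and f: "f = (\<lambda>x. (\<Sum>\<alpha>\<in>A. c \<alpha> * exp (\<alpha> \<bullet> x)) + (\<Sum>\<beta>\<in>B. c \<beta> * exp (\<beta> \<bullet> x)))"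
  shows "f \<in> C_SAGE A B \<longleftrightarrow>
    (\<exists>C \<nu>. (\<forall>\<beta>\<in>B. age_certificate A \<beta> (c \<beta>) (C \<beta>) (\<nu> \<beta>)) \<and> (\<forall>\<alpha>\<in>A. (\<Sum>\<beta>\<in>B. C \<beta> \<alpha>) \<le> c \<alpha>))"
proof -
  define E where "E = A \<union> B"
  have finE: "finite E" using finA finB by (simp add: E_def)
  have f_E: "f x = (\<Sum>\<gamma>\<in>E. c \<gamma> * exp (\<gamma> \<bullet> x))" for x
    unfolding f E_def using finA finB disj by (simp add: sum.union_disjoint)
  have split_E: "(\<Sum>\<gamma>\<in>E. d \<gamma>) = (\<Sum>\<gamma>\<in>E - {\<beta>}. d \<gamma>) + d \<beta>" if "\<beta> \<in> B"
    for \<beta> and d :: "real ^ 'n \<Rightarrow> real"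
    using finE that by (subst sum.remove[of E \<beta>]) (auto simp: E_def)
  have restrict: "(\<Sum>\<gamma>\<in>E - {\<beta>}. d \<gamma>) = (\<Sum>\<gamma>\<in>A. d \<gamma>)"
    if "\<beta> \<in> B" "\<And>\<gamma>. \<gamma> \<in> B \<Longrightarrow> \<gamma> \<noteq> \<beta> \<Longrightarrow> d \<gamma> = 0" for \<beta> and d :: "real ^ 'n \<Rightarrow> real"
    using finE that disj by (intro sum.mono_neutral_right) (auto simp: E_def)
  show ?thesis
  proof
    assume "f \<in> C_SAGE A B"
    then obtain g where g: "\<forall>\<beta>\<in>B. g \<beta> \<in> C_AGE (E - {\<beta>}) \<beta>" and fg: "f = (\<lambda>x. \<Sum>\<beta>\<in>B. g \<beta> x)"
      by (auto simp: C_SAGE_alt[OF finB] E_def)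
    from g have "\<forall>\<beta>\<in>B. \<exists>d. (\<forall>\<gamma>\<in>E - {\<beta>}. 0 \<le> d \<gamma>) \<and>
        g \<beta> = (\<lambda>x. (\<Sum>\<gamma>\<in>E - {\<beta>}. d \<gamma> * exp (\<gamma> \<bullet> x)) + d \<beta> * exp (\<beta> \<bullet> x)) \<and> (\<forall>x. 0 \<le> g \<beta> x)"
      by (simp add: C_AGE_def)
    then obtain D where D: "\<forall>\<beta>\<in>B. (\<forall>\<gamma>\<in>E - {\<beta>}. 0 \<le> D \<beta> \<gamma>) \<and>
        g \<beta> = (\<lambda>x. (\<Sum>\<gamma>\<in>E - {\<beta>}. D \<beta> \<gamma> * exp (\<gamma> \<bullet> x)) + D \<beta> \<beta> * exp (\<beta> \<bullet> x)) \<and> (\<forall>x. 0 \<le> g \<beta> x)"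
      by (auto dest!: bchoice)
    have gD: "g \<beta> x = (\<Sum>\<gamma>\<in>E. D \<beta> \<gamma> * exp (\<gamma> \<bullet> x))" if "\<beta> \<in> B" for \<beta> x
      using D that split_E[OF that] by simp
    have total: "\<forall>\<gamma>\<in>E. (\<Sum>\<beta>\<in>B. D \<beta> \<gamma>) = c \<gamma>"
    proof (rule ballI, rule exp_inner_coeff_eq[OF finE])
      fix x
      have "(\<Sum>\<gamma>\<in>E. (\<Sum>\<beta>\<in>B. D \<beta> \<gamma>) * exp (\<gamma> \<bullet> x)) = (\<Sum>\<beta>\<in>B. \<Sum>\<gamma>\<in>E. D \<beta> \<gamma> * exp (\<gamma> \<bullet> x))"
        unfolding sum_distrib_right by (rule sum.swap)
      also have "\<dots> = f x" by (simp add: fg gD)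
      finally show "(\<Sum>\<gamma>\<in>E. (\<Sum>\<beta>\<in>B. D \<beta> \<gamma>) * exp (\<gamma> \<bullet> x)) = (\<Sum>\<gamma>\<in>E. c \<gamma> * exp (\<gamma> \<bullet> x))"
        by (simp add: f_E)
    qed
    have D_off: "\<forall>\<beta>\<in>B. \<forall>\<gamma>\<in>E. \<gamma> \<noteq> \<beta> \<longrightarrow> 0 \<le> D \<beta> \<gamma>"
      using D by blast
    have D_nonneg: "\<forall>\<beta>\<in>B. \<forall>x. 0 \<le> (\<Sum>\<gamma>\<in>E. D \<beta> \<gamma> * exp (\<gamma> \<bullet> x))"
    proof (intro ballI allI)
      fix \<beta> x assume "\<beta> \<in> B"
      then have "0 \<le> g \<beta> x" using D by blast
      then show "0 \<le> (\<Sum>\<gamma>\<in>E. D \<beta> \<gamma> * exp (\<gamma> \<bullet> x))" by (simp only: gD[OF \<open>\<beta> \<in> B\<close>])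
    qed
    have "B \<subseteq> E" by (simp add: E_def)
    obtain C where C_off: "\<forall>\<beta>\<in>B. \<forall>\<gamma>\<in>E. \<gamma> \<noteq> \<beta> \<longrightarrow> 0 \<le> C \<beta> \<gamma>"
      and C_nonneg: "\<forall>\<beta>\<in>B. \<forall>x. 0 \<le> (\<Sum>\<gamma>\<in>E. C \<beta> \<gamma> * exp (\<gamma> \<bullet> x))"
      and C_total: "\<forall>\<gamma>\<in>E. (\<Sum>\<beta>\<in>B. C \<beta> \<gamma>) = c \<gamma>"
      and C_zero: "\<forall>\<gamma>\<in>B. \<forall>\<beta>\<in>B. \<beta> \<noteq> \<gamma> \<longrightarrow> C \<beta> \<gamma> = 0"
      using eliminate_negative_exponents[OF finE finB \<open>B \<subseteq> E\<close> D_off D_nonneg total neg finB subset_refl]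
      by (elim exE conjE) (rule that)
    have "\<exists>\<nu>. age_certificate A \<beta> (c \<beta>) (C \<beta>) \<nu>" if "\<beta> \<in> B" for \<beta>
    proof -
      have "(\<Sum>\<gamma>\<in>B. C \<gamma> \<beta>) = C \<beta> \<beta>"
        using finB that C_zero by (subst sum.remove[of B \<beta>]) auto
      then have "C \<beta> \<beta> = c \<beta>" using C_total that by (simp add: E_def)
      moreover have "(\<Sum>\<gamma>\<in>E - {\<beta>}. C \<beta> \<gamma> * exp (\<gamma> \<bullet> x)) = (\<Sum>\<alpha>\<in>A. C \<beta> \<alpha> * exp (\<alpha> \<bullet> x))" for x
        by (rule restrict[OF that]) (use C_zero that in auto)
      ultimately have "0 \<le> (\<Sum>\<alpha>\<in>A. C \<beta> \<alpha> * exp (\<alpha> \<bullet> x)) + c \<beta> * exp (\<beta> \<bullet> x)" for x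
        using bspec[OF C_nonneg that] by (simp add: split_E[OF that])
      moreover have "\<forall>\<alpha>\<in>A. 0 \<le> C \<beta> \<alpha>"
      proof
        fix \<alpha> assume "\<alpha> \<in> A"
        then have "\<alpha> \<in> E" "\<alpha> \<noteq> \<beta>" using disj that by (auto simp: E_def)
        then show "0 \<le> C \<beta> \<alpha>" using C_off that by simp
      qed
      ultimately show ?thesis by (intro age_nonneg_iff[OF finA, THEN iffD1]) simp
    qed
    then have "\<exists>\<nu>. \<forall>\<beta>\<in>B. age_certificate A \<beta> (c \<beta>) (C \<beta>) (\<nu> \<beta>)" by (intro bchoice) blast
    then obtain \<nu> where "\<forall>\<beta>\<in>B. age_certificate A \<beta> (c \<beta>) (C \<beta>) (\<nu> \<beta>)" by blast
    moreover have "\<forall>\<alpha>\<in>A. (\<Sum>\<beta>\<in>B. C \<beta> \<alpha>) \<le> c \<alpha>" using C_total by (simp add: E_def)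
    ultimately show "\<exists>C \<nu>. (\<forall>\<beta>\<in>B. age_certificate A \<beta> (c \<beta>) (C \<beta>) (\<nu> \<beta>)) \<and>
        (\<forall>\<alpha>\<in>A. (\<Sum>\<beta>\<in>B. C \<beta> \<alpha>) \<le> c \<alpha>)" by blast
  next
    assume "\<exists>C \<nu>. (\<forall>\<beta>\<in>B. age_certificate A \<beta> (c \<beta>) (C \<beta>) (\<nu> \<beta>)) \<and>
        (\<forall>\<alpha>\<in>A. (\<Sum>\<beta>\<in>B. C \<beta> \<alpha>) \<le> c \<alpha>)"
    then obtain C \<nu> where cert: "\<And>\<beta>. \<beta> \<in> B \<Longrightarrow> age_certificate A \<beta> (c \<beta>) (C \<beta>) (\<nu> \<beta>)"
      and total: "\<And>\<alpha>. \<alpha> \<in> A \<Longrightarrow> (\<Sum>\<beta>\<in>B. C \<beta> \<alpha>) \<le> c \<alpha>" by blast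
    have C: "(\<forall>\<alpha>\<in>A. 0 \<le> C \<beta> \<alpha>) \<and> (\<forall>x. 0 \<le> (\<Sum>\<alpha>\<in>A. C \<beta> \<alpha> * exp (\<alpha> \<bullet> x)) + c \<beta> * exp (\<beta> \<bullet> x))"
      if "\<beta> \<in> B" for \<beta>
      using age_nonneg_iff[OF finA] cert[OF that] by blast
    obtain \<beta>\<^sub>0 where \<beta>\<^sub>0: "\<beta>\<^sub>0 \<in> B" using \<open>B \<noteq> {}\<close> by blast
    define s where "s = (\<lambda>\<alpha>. c \<alpha> - (\<Sum>\<beta>\<in>B. C \<beta> \<alpha>))"
    define D where "D = (\<lambda>\<beta> \<alpha>. C \<beta> \<alpha> + (if \<beta> = \<beta>\<^sub>0 then s \<alpha> else 0))"
    define g where "g = (\<lambda>\<beta> x. (\<Sum>\<alpha>\<in>A. D \<beta> \<alpha> * exp (\<alpha> \<bullet> x)) + c \<beta> * exp (\<beta> \<bullet> x))"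
    have s_nonneg: "0 \<le> s \<alpha>" if "\<alpha> \<in> A" for \<alpha> using total[OF that] by (simp add: s_def)
    have D_ge: "C \<beta> \<alpha> \<le> D \<beta> \<alpha>" if "\<alpha> \<in> A" for \<beta> \<alpha> using s_nonneg[OF that] by (simp add: D_def)
    have D_sum: "(\<Sum>\<beta>\<in>B. D \<beta> \<alpha>) = c \<alpha>" for \<alpha>
      using finB \<beta>\<^sub>0 by (simp add: D_def sum.distrib s_def)
    have "g \<beta> \<in> C_AGE (E - {\<beta>}) \<beta>" if "\<beta> \<in> B" for \<beta>
    proof -
      define d where "d = (\<lambda>\<gamma>. if \<gamma> \<in> A then D \<beta> \<gamma> else if \<gamma> = \<beta> then c \<beta> else 0)"
      have "\<beta> \<notin> A" using that disj by blast
      have D_nonneg: "0 \<le> D \<beta> \<gamma>" if "\<gamma> \<in> A" for \<gamma>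
        using C[OF \<open>\<beta> \<in> B\<close>] D_ge[OF that, of \<beta>] that by (meson order_trans)
      have "\<forall>\<gamma>\<in>E - {\<beta>}. 0 \<le> d \<gamma>" by (simp add: d_def D_nonneg)
      moreover have "g \<beta> = (\<lambda>x. (\<Sum>\<gamma>\<in>E - {\<beta>}. d \<gamma> * exp (\<gamma> \<bullet> x)) + d \<beta> * exp (\<beta> \<bullet> x))"
      proof
        fix x
        have "(\<Sum>\<gamma>\<in>E - {\<beta>}. d \<gamma> * exp (\<gamma> \<bullet> x)) = (\<Sum>\<gamma>\<in>A. d \<gamma> * exp (\<gamma> \<bullet> x))"
          by (rule restrict[OF that]) (use disj in \<open>auto simp: d_def\<close>)
        then show "g \<beta> x = (\<Sum>\<gamma>\<in>E - {\<beta>}. d \<gamma> * exp (\<gamma> \<bullet> x)) + d \<beta> * exp (\<beta> \<bullet> x)"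
          using \<open>\<beta> \<notin> A\<close> by (simp add: g_def d_def)
      qed
      moreover have "0 \<le> g \<beta> x" for x
      proof -
        have "(\<Sum>\<alpha>\<in>A. C \<beta> \<alpha> * exp (\<alpha> \<bullet> x)) \<le> (\<Sum>\<alpha>\<in>A. D \<beta> \<alpha> * exp (\<alpha> \<bullet> x))"
          using D_ge by (intro sum_mono mult_right_mono) auto
        moreover have "0 \<le> (\<Sum>\<alpha>\<in>A. C \<beta> \<alpha> * exp (\<alpha> \<bullet> x)) + c \<beta> * exp (\<beta> \<bullet> x)"
          using C[OF that] by blast
        ultimately show ?thesis by (simp add: g_def)
      qed
      ultimately show ?thesis unfolding C_AGE_def by blast
    qed
    moreover have "f = (\<lambda>x. \<Sum>\<beta>\<in>B. g \<beta> x)"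
    proof
      fix x
      have "(\<Sum>\<beta>\<in>B. \<Sum>\<alpha>\<in>A. D \<beta> \<alpha> * exp (\<alpha> \<bullet> x)) = (\<Sum>\<alpha>\<in>A. (\<Sum>\<beta>\<in>B. D \<beta> \<alpha>) * exp (\<alpha> \<bullet> x))"
        unfolding sum_distrib_right by (rule sum.swap)
      then show "f x = (\<Sum>\<beta>\<in>B. g \<beta> x)" by (simp add: f g_def sum.distrib D_sum)
    qed
    ultimately show "f \<in> C_SAGE A B" by (auto simp: C_SAGE_alt[OF finB] E_def)
  qed
qed

subsection \<open>Sums over orbits\<close>

lemma (in group) sum_group_mult_right:
  assumes "k \<in> carrier G"
  shows "(\<Sum>g\<in>carrier G. h (g \<otimes> k)) = (\<Sum>g\<in>carrier G. h g)"
  by (rule sum.reindex_bij_witness[where i = "\<lambda>g. g \<otimes> inv k" and j = "\<lambda>g. g \<otimes> k"])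
    (use assms in \<open>auto simp: m_assoc\<close>)

lemma (in group) sum_group_inv:
  "(\<Sum>g\<in>carrier G. h (inv g)) = (\<Sum>g\<in>carrier G. h g)"
  by (rule sum.reindex_bij_witness[where i = "\<lambda>g. inv g" and j = "\<lambda>g. inv g"]) auto

text \<open>Orbit-stabiliser in weighted form: the fibres of \<open>g \<mapsto> \<phi> g x\<close>
  over the orbit are the left cosets of the stabiliser of x, so all have its cardinality.\<close>

lemma (in group_action) sum_over_group:
  fixes h :: "'c \<Rightarrow> real"
  assumes fin: "finite (carrier G)" and x: "x \<in> E"
  shows "(\<Sum>g\<in>carrier G. h (\<phi> g x)) = card (stabilizer G \<phi> x) * (\<Sum>y\<in>orbit G \<phi> x. h y)"
proof -
  interpret group G using group_hom group_hom.axioms(1) by blast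
  have orb: "orbit G \<phi> x = (\<lambda>g. \<phi> g x) ` carrier G" by (auto simp: orbit_def)
  have fibre: "card {g \<in> carrier G. \<phi> g x = y} = card (stabilizer G \<phi> x)"
    if "y \<in> orbit G \<phi> x" for y
  proof -
    obtain k where k: "k \<in> carrier G" "\<phi> k x = y" using \<open>y \<in> orbit G \<phi> x\<close> by (auto simp: orbit_def)
    have inv_k: "\<phi> (inv k) y = x" using orbit_sym_aux k x by blast
    have y: "y \<in> E" using k x element_image by blast
    have "bij_betw (\<lambda>g. k \<otimes> g) (stabilizer G \<phi> x) {g \<in> carrier G. \<phi> g x = y}"
      by (rule bij_betwI[where g = "\<lambda>g. inv k \<otimes> g"])
        (use k x y inv_k in \<open>auto simp: stabilizer_def composition_rule m_assoc[symmetric]\<close>)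
    then show ?thesis by (simp add: bij_betw_same_card)
  qed
  have "(\<Sum>g\<in>carrier G. h (\<phi> g x)) =
      (\<Sum>y\<in>orbit G \<phi> x. \<Sum>g\<in>{g \<in> carrier G. \<phi> g x = y}. h (\<phi> g x))"
    unfolding orb using fin by (rule sum.image_gen)
  also have "\<dots> = (\<Sum>y\<in>orbit G \<phi> x. card (stabilizer G \<phi> x) * h y)"
    by (intro sum.cong) (simp_all add: fibre)
  finally show ?thesis by (simp add: sum_distrib_left)
qed

lemma (in group_action) card_stabilizer_pos:
  assumes "finite (carrier G)" and "x \<in> E"
  shows "0 < card (stabilizer G \<phi> x)"
  using assms stabilizer_one_closed[OF assms(2)] finite_subset[OF stabilizer_subset]
  by (metis card_gt_0_iff empty_iff)

lemma (in group_action) orbit_eq: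
  assumes "x \<in> E" and "y \<in> orbit G \<phi> x"
  shows "orbit G \<phi> y = orbit G \<phi> x"
proof -
  have y: "y \<in> E" using assms element_image by (auto simp: orbit_def)
  have "z \<in> E" if "z \<in> orbit G \<phi> x \<or> z \<in> orbit G \<phi> y" for z
    using that assms(1) y element_image by (auto simp: orbit_def)
  with y assms show ?thesis by (meson orbit_sym orbit_trans subsetI subset_antisym)
qed

lemma (in group_action) sum_over_orbits:
  fixes h :: "'c \<Rightarrow> 'd::comm_monoid_add"
  assumes "finite S" and "S \<subseteq> E" and stable: "\<And>x. x \<in> S \<Longrightarrow> orbit G \<phi> x \<subseteq> S"
  shows "(\<Sum>Orb\<in>orbits G S \<phi>. \<Sum>x\<in>Orb. h x) = (\<Sum>x\<in>S. h x)"
proof -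
  have "(\<Sum>x\<in>\<Union> (orbits G S \<phi>). h x) = (\<Sum>Orb\<in>orbits G S \<phi>. \<Sum>x\<in>Orb. h x)"
  proof (subst sum.Union_disjoint)
    show "\<forall>Orb\<in>orbits G S \<phi>. finite Orb"
      using stable \<open>finite S\<close> by (auto simp: orbits_def intro: finite_subset)
    show "\<forall>P\<in>orbits G S \<phi>. \<forall>Q\<in>orbits G S \<phi>. P \<noteq> Q \<longrightarrow> P \<inter> Q = {}"
      using disjoint_union \<open>S \<subseteq> E\<close> unfolding orbits_def by blast
  qed simp
  moreover have "\<Union> (orbits G S \<phi>) = S"
    using stable orbit_refl \<open>S \<subseteq> E\<close> by (fastforce simp: orbits_def)
  ultimately show ?thesis by simp
qed

text \<open>Inclusion-minimality is used here: intersecting orbits coincide, so one of two distinct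
  representatives could be dropped without losing any point of S.\<close>

lemma (in group_action) orbit_reps_unique:
  assumes "S \<subseteq> E" and reps: "orbit_reps G \<phi> S R" and xy: "x \<in> R" "y \<in> R"
    and meet: "orbit G \<phi> x \<inter> orbit G \<phi> y \<noteq> {}"
  shows "x = y"
proof (rule ccontr)
  assume "x \<noteq> y"
  have R: "R \<subseteq> S" and cover: "(\<Union>x\<in>R. orbit G \<phi> x) = S"
    and minimal: "\<And>T. T \<subset> R \<Longrightarrow> (\<Union>x\<in>T. orbit G \<phi> x) \<noteq> S"
    using reps by (auto simp: orbit_reps_def)
  obtain z where z: "z \<in> orbit G \<phi> x" "z \<in> orbit G \<phi> y" using meet by auto
  have "orbit G \<phi> y = orbit G \<phi> x"
    using orbit_eq[OF _ z(1)] orbit_eq[OF _ z(2)] xy R \<open>S \<subseteq> E\<close> by auto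
  with \<open>x \<noteq> y\<close> \<open>x \<in> R\<close> have "(\<Union>u\<in>R - {y}. orbit G \<phi> u) = (\<Union>u\<in>R. orbit G \<phi> u)" by blast
  then show False using minimal[of "R - {y}"] cover \<open>y \<in> R\<close> by blast
qed

text \<open>The division removes the multiplicity with which the group sum visits the points of an
  orbit. In this form a sum over S becomes open to substitutions in the group.\<close>

lemma (in group_action) sum_over_orbit_reps:
  fixes h :: "'c \<Rightarrow> real"
  assumes fin: "finite (carrier G)" and "finite S" and "S \<subseteq> E" and reps: "orbit_reps G \<phi> S R"
  shows "(\<Sum>x\<in>R. (\<Sum>g\<in>carrier G. h (\<phi> g x)) / card (stabilizer G \<phi> x)) = (\<Sum>x\<in>S. h x)"
proof -
  have R: "R \<subseteq> S" and cover: "(\<Union>x\<in>R. orbit G \<phi> x) = S"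
    using reps by (auto simp: orbit_reps_def)
  have "(\<Sum>x\<in>R. (\<Sum>g\<in>carrier G. h (\<phi> g x)) / card (stabilizer G \<phi> x)) =
      (\<Sum>x\<in>R. \<Sum>y\<in>orbit G \<phi> x. h y)"
  proof (rule sum.cong)
    fix x assume "x \<in> R"
    then have "x \<in> E" using R \<open>S \<subseteq> E\<close> by blast
    then show "(\<Sum>g\<in>carrier G. h (\<phi> g x)) / card (stabilizer G \<phi> x) = (\<Sum>y\<in>orbit G \<phi> x. h y)"
      using card_stabilizer_pos[OF fin] by (simp add: sum_over_group[OF fin])
  qed simp
  also have "\<dots> = (\<Sum>y\<in>(\<Union>x\<in>R. orbit G \<phi> x). h y)"
  proof (subst sum.UNION_disjoint)
    show "finite R" using R \<open>finite S\<close> finite_subset by blast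
    show "\<forall>x\<in>R. finite (orbit G \<phi> x)"
      using cover \<open>finite S\<close> by (metis UN_upper finite_subset)
    show "\<forall>x\<in>R. \<forall>y\<in>R. x \<noteq> y \<longrightarrow> orbit G \<phi> x \<inter> orbit G \<phi> y = {}"
      using orbit_reps_unique[OF \<open>S \<subseteq> E\<close> reps] by blast
  qed simp
  finally show ?thesis by (simp add: cover)
qed

text \<open>S is the union of the full orbits of its representatives, so stability is built into the
  notion of representatives.\<close>

lemma (in group_action) orbit_reps_stable:
  assumes "S \<subseteq> E" and "orbit_reps G \<phi> S R" and "g \<in> carrier G" and "x \<in> S"
  shows "\<phi> g x \<in> S"
proof -
  obtain y where y: "y \<in> R" "x \<in> orbit G \<phi> y" and "orbit G \<phi> y \<subseteq> S"
    using assms by (auto simp: orbit_reps_def)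
  have "y \<in> E" using assms y by (auto simp: orbit_reps_def)
  then have "orbit G \<phi> x = orbit G \<phi> y" using orbit_eq y by blast
  moreover have "\<phi> g x \<in> orbit G \<phi> x" using assms by (auto simp: orbit_def)
  ultimately show ?thesis using \<open>orbit G \<phi> y \<subseteq> S\<close> by auto
qed

lemma (in group_action) orbit_reps_cover:
  assumes "S \<subseteq> E" and "orbit_reps G \<phi> S R" and "x \<in> S"
  obtains g y where "g \<in> carrier G" and "y \<in> R" and "x = \<phi> g y"
  using assms by (auto simp: orbit_reps_def orbit_def)

lemma (in group_action) bij_betw_stable:
  assumes "S \<subseteq> E" and stable: "\<And>g x. g \<in> carrier G \<Longrightarrow> x \<in> S \<Longrightarrow> \<phi> g x \<in> S" and g: "g \<in> carrier G"
  shows "bij_betw (\<phi> g) S S"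
proof -
  interpret group G using group_hom group_hom.axioms(1) by blast
  have inv: "\<phi> (inv g) (\<phi> g x) = x" "\<phi> g (\<phi> (inv g) x) = x" if "x \<in> S" for x
    using that assms orbit_sym_aux[OF g, of x] orbit_sym_aux[of "inv g" x] by auto
  show ?thesis
    by (rule bij_betwI[where g = "\<phi> (inv g)"]) (use assms inv in auto)
qed

lemma (in group_action) sum_over_stab_orbits:
  fixes h :: "'c \<Rightarrow> 'd::comm_monoid_add"
  assumes "finite S" and "S \<subseteq> E" and stable: "\<And>g y. g \<in> carrier G \<Longrightarrow> y \<in> S \<Longrightarrow> \<phi> g y \<in> S"
    and x: "x \<in> E"
  shows "(\<Sum>Orb\<in>stab_orbits G \<phi> S x. \<Sum>y\<in>Orb. h y) = (\<Sum>y\<in>S. h y)"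
proof -
  interpret group G using group_hom group_hom.axioms(1) by blast
  interpret H: group_action "G\<lparr>carrier := stabilizer G \<phi> x\<rparr>" E \<phi>
    using induced_action[OF stabilizer_subgroup[OF x]] .
  show ?thesis unfolding stab_orbits_def
    by (rule H.sum_over_orbits) (use assms stabilizer_subset[of x] in \<open>auto simp: orbit_def\<close>)
qed

lemma (in group_action) stab_orbits_member_eq:
  assumes "S \<subseteq> E" and x: "x \<in> E" and "Orb \<in> stab_orbits G \<phi> S x" and "y \<in> Orb"
  shows "orbit (G\<lparr>carrier := stabilizer G \<phi> x\<rparr>) \<phi> y = Orb"
proof -
  interpret group G using group_hom group_hom.axioms(1) by blast
  interpret H: group_action "G\<lparr>carrier := stabilizer G \<phi> x\<rparr>" E \<phi>
    using induced_action[OF stabilizer_subgroup[OF x]] .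
  show ?thesis using assms H.orbit_eq by (auto simp: stab_orbits_def orbits_def)
qed

lemma (in group_action) stab_orbits_memberE:
  assumes x: "x \<in> E" and "S \<subseteq> E" and "Orb \<in> stab_orbits G \<phi> S x"
    and "y \<in> Orb" and "z \<in> Orb"
  obtains g where "g \<in> carrier G" and "\<phi> g x = x" and "z = \<phi> g y"
proof -
  have "z \<in> orbit (G\<lparr>carrier := stabilizer G \<phi> x\<rparr>) \<phi> y"
    using stab_orbits_member_eq[OF \<open>S \<subseteq> E\<close> x assms(3,4)] assms(5) by simp
  then show thesis using that by (auto simp: orbit_def stabilizer_def)
qed

lemma (in group_action) stab_orbits_finite_nonempty:
  assumes "finite S" and "S \<subseteq> E" and stable: "\<And>g y. g \<in> carrier G \<Longrightarrow> y \<in> S \<Longrightarrow> \<phi> g y \<in> S"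
    and x: "x \<in> E"
  shows "finite (stab_orbits G \<phi> S x)"
    and "\<And>Orb. Orb \<in> stab_orbits G \<phi> S x \<Longrightarrow> finite Orb \<and> Orb \<noteq> {} \<and> Orb \<subseteq> S"
proof -
  interpret group G using group_hom group_hom.axioms(1) by blast
  show "finite (stab_orbits G \<phi> S x)"
    using \<open>finite S\<close> by (auto simp: stab_orbits_def orbits_def)
  fix Orb assume Orb: "Orb \<in> stab_orbits G \<phi> S x"
  then have "Orb \<subseteq> S" using stable by (auto simp: stab_orbits_def orbits_def orbit_def stabilizer_def)
  moreover have "Orb \<noteq> {}"
    using Orb stabilizer_one_closed[OF x] by (auto simp: stab_orbits_def orbits_def orbit_def)
  ultimately show "finite Orb \<and> Orb \<noteq> {} \<and> Orb \<subseteq> S" using \<open>finite S\<close> finite_subset by blast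
qed

lemma (in group_action) stab_orbits_mono:
  "S \<subseteq> T \<Longrightarrow> stab_orbits G \<phi> S x \<subseteq> stab_orbits G \<phi> T x"
  by (auto simp: stab_orbits_def orbits_def)

text \<open>The vector k on orbits and the function h constant on them carry the same data; the
  cardinality of an orbit counts how often its value occurs on S.\<close>

lemma (in group_action) sum_stab_orbits_card:
  fixes h :: "'c \<Rightarrow> real"
  assumes "finite S" and "S \<subseteq> E" and "\<And>g y. g \<in> carrier G \<Longrightarrow> y \<in> S \<Longrightarrow> \<phi> g y \<in> S" and "x \<in> E"
    and const: "\<And>Orb y. Orb \<in> stab_orbits G \<phi> S x \<Longrightarrow> y \<in> Orb \<Longrightarrow> h y = k Orb"
  shows "(\<Sum>Orb\<in>stab_orbits G \<phi> S x. real (card Orb) * k Orb) = (\<Sum>y\<in>S. h y)"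
proof -
  have "(\<Sum>Orb\<in>stab_orbits G \<phi> S x. real (card Orb) * k Orb) =
      (\<Sum>Orb\<in>stab_orbits G \<phi> S x. \<Sum>y\<in>Orb. h y)"
    by (rule sum.cong) (simp_all add: const)
  also have "\<dots> = (\<Sum>y\<in>S. h y)" by (rule sum_over_stab_orbits[OF assms(1-4)])
  finally show ?thesis .
qed

section \<open>Equivariant families, and the stabiliser weights\<close>

text \<open>H at z is read off from an arbitrary presentation of z as \<open>\<phi> g x\<close>. The
  representative x is determined by z, and two choices of g differ by an element of the stabiliser
  of x, under which \<open>h x\<close> is invariant. The defining equation says that H is invariant
  under the diagonal action on pairs.\<close>

lemma (in group_action) equivariant_extension:
  assumes "S \<subseteq> E" and reps: "orbit_reps G \<phi> S R"
    and inv: "\<And>x g y. x \<in> R \<Longrightarrow> g \<in> carrier G \<Longrightarrow> \<phi> g x = x \<Longrightarrow> y \<in> E \<Longrightarrow> h x (\<phi> g y) = h x y"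
  obtains H where "\<And>x g y. x \<in> R \<Longrightarrow> g \<in> carrier G \<Longrightarrow> y \<in> E \<Longrightarrow>
    H (\<phi> g x) y = h x (\<phi> (inv g) y)"
proof -
  interpret group G using group_hom group_hom.axioms(1) by blast
  define Q where "Q = (\<lambda>z (x, g). x \<in> R \<and> g \<in> carrier G \<and> z = \<phi> g x)"
  define H where "H = (\<lambda>z y. case SOME p. Q z p of (x, g) \<Rightarrow> h x (\<phi> (inv g) y))"
  have "H (\<phi> g x) y = h x (\<phi> (inv g) y)"
    if x: "x \<in> R" and g: "g \<in> carrier G" and y: "y \<in> E" for x g y
  proof -
    have "Q (\<phi> g x) (x, g)" using x g by (simp add: Q_def)
    then have "Q (\<phi> g x) (SOME p. Q (\<phi> g x) p)" by (rule someI)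
    moreover obtain x' s where p: "(SOME p. Q (\<phi> g x) p) = (x', s)" by fastforce
    ultimately have x': "x' \<in> R" and s: "s \<in> carrier G" and eq: "\<phi> g x = \<phi> s x'"
      by (auto simp: Q_def)
    have xE: "x \<in> E" using x reps \<open>S \<subseteq> E\<close> by (auto simp: orbit_reps_def)
    have "\<phi> g x \<in> orbit G \<phi> x" using g by (auto simp: orbit_def)
    moreover have "\<phi> g x \<in> orbit G \<phi> x'" unfolding eq using s by (auto simp: orbit_def)
    ultimately have [simp]: "x' = x" using orbit_reps_unique[OF \<open>S \<subseteq> E\<close> reps x x'] by auto
    let ?k = "inv s \<otimes> g"
    have "\<phi> ?k x = x"
      using composition_rule[OF xE, of "inv s" g] orbit_sym_aux[OF s xE, of "\<phi> s x"] s g eq by simp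
    moreover have "\<phi> (inv s) y = \<phi> ?k (\<phi> (inv g) y)"
      using s g y by (simp add: m_assoc flip: composition_rule)
    moreover have "\<phi> (inv g) y \<in> E" using g y element_image by blast
    ultimately have "h x (\<phi> (inv s) y) = h x (\<phi> (inv g) y)" using inv[OF x, of ?k] s g by simp
    then show ?thesis by (simp add: H_def p)
  qed
  then show thesis by (rule that)
qed

lemma (in group_action) sum_group_shift:
  assumes "k \<in> carrier G" and "x \<in> E"
  shows "(\<Sum>g\<in>carrier G. h (\<phi> g (\<phi> k x))) = (\<Sum>g\<in>carrier G. h (\<phi> g x))"
proof -
  interpret group G using group_hom group_hom.axioms(1) by blast
  have "(\<Sum>g\<in>carrier G. h (\<phi> g (\<phi> k x))) = (\<Sum>g\<in>carrier G. h (\<phi> (g \<otimes> k) x))"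
    using assms by (intro sum.cong) (auto simp: composition_rule)
  also have "\<dots> = (\<Sum>g\<in>carrier G. h (\<phi> g x))" by (rule sum_group_mult_right[OF assms(1)])
  finally show ?thesis .
qed

text \<open>Replacing g by its inverse in the group sum moves the action from the first argument of
  H to the second. The sum over S at fixed y thus becomes a sum over the orbit of y at fixed
  representatives.\<close>

lemma (in group_action) sum_equivariant:
  fixes h H :: "'c \<Rightarrow> 'c \<Rightarrow> real"
  assumes fin: "finite (carrier G)" and "finite S" and "S \<subseteq> E" and reps: "orbit_reps G \<phi> S R"
    and H: "\<And>x g. x \<in> R \<Longrightarrow> g \<in> carrier G \<Longrightarrow> H (\<phi> g x) y = h x (\<phi> (inv g) y)"
  shows "(\<Sum>x\<in>R. (\<Sum>g\<in>carrier G. h x (\<phi> g y)) / card (stabilizer G \<phi> x)) = (\<Sum>x\<in>S. H x y)"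
proof -
  interpret group G using group_hom group_hom.axioms(1) by blast
  have "(\<Sum>x\<in>R. (\<Sum>g\<in>carrier G. h x (\<phi> g y)) / card (stabilizer G \<phi> x)) =
      (\<Sum>x\<in>R. (\<Sum>g\<in>carrier G. H (\<phi> g x) y) / card (stabilizer G \<phi> x))"
  proof (rule sum.cong)
    fix x assume "x \<in> R"
    then have "(\<Sum>g\<in>carrier G. H (\<phi> g x) y) = (\<Sum>g\<in>carrier G. h x (\<phi> (inv g) y))"
      by (intro sum.cong) (simp_all add: H)
    also have "\<dots> = (\<Sum>g\<in>carrier G. h x (\<phi> g y))"
      by (rule sum_group_inv[of "\<lambda>g. h x (\<phi> g y)"])
    finally show "(\<Sum>g\<in>carrier G. h x (\<phi> g y)) / card (stabilizer G \<phi> x) =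
        (\<Sum>g\<in>carrier G. H (\<phi> g x) y) / card (stabilizer G \<phi> x)" by simp
  qed simp
  also have "\<dots> = (\<Sum>x\<in>S. H x y)" by (rule sum_over_orbit_reps[OF fin \<open>finite S\<close> \<open>S \<subseteq> E\<close> reps])
  finally show ?thesis .
qed

text \<open>The left side has the shape of the weighted sums in the theorem. Its numerator is the
  multiplicity with which the group meets each point of the orbit of y; its denominator is the one
  that \<open>sum_equivariant\<close> requires for x.\<close>

lemma (in group_action) weighted_orbit_sum:
  fixes h :: "'c \<Rightarrow> real"
  assumes fin: "finite (carrier G)" and "S \<subseteq> E" and x: "x \<in> E" and y: "y \<in> S"
    and stable: "\<And>g z. g \<in> carrier G \<Longrightarrow> z \<in> S \<Longrightarrow> \<phi> g z \<in> S"
    and const: "\<And>Orb z. Orb \<in> stab_orbits G \<phi> S x \<Longrightarrow> z \<in> Orb \<Longrightarrow> h z = k Orb"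
  shows "card (stabilizer G \<phi> y) / card (stabilizer G \<phi> x) *
      (\<Sum>Orb\<in>stab_orbits G \<phi> (orbit G \<phi> y) x. real (card Orb) * k Orb) =
    (\<Sum>g\<in>carrier G. h (\<phi> g y)) / card (stabilizer G \<phi> x)"
proof -
  have yE: "y \<in> E" using y \<open>S \<subseteq> E\<close> by blast
  have sub: "orbit G \<phi> y \<subseteq> S" using stable y by (auto simp: orbit_def)
  have "finite (orbit G \<phi> y)" using fin by (simp add: orbit_def)
  moreover have "\<phi> g z \<in> orbit G \<phi> y" if "g \<in> carrier G" "z \<in> orbit G \<phi> y" for g z
    using that orbit_eq[OF yE that(2)] by (auto simp: orbit_def)
  moreover have "orbit G \<phi> y \<subseteq> E" using sub \<open>S \<subseteq> E\<close> by blast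
  ultimately have "(\<Sum>Orb\<in>stab_orbits G \<phi> (orbit G \<phi> y) x. real (card Orb) * k Orb) =
      (\<Sum>z\<in>orbit G \<phi> y. h z)"
    using const stab_orbits_mono[OF sub] x by (intro sum_stab_orbits_card) blast+
  then show ?thesis by (simp add: sum_over_group[OF fin yE])
qed

subsection \<open>Certificates under a group action\<close>

text \<open>The relative entropy is jointly convex and homogeneous, so averaging over the diagonal action
  on pairs of exponents preserves certificates.\<close>

lemma invariant_age_certificate:
  fixes X :: "'g \<Rightarrow> 'a::real_inner \<Rightarrow> 'a"
  assumes act: "group_action G UNIV X" and fin: "finite (carrier G)"
    and lin: "\<And>g. linear (X g)" and finA: "finite A" and finB: "finite B"
    and stA: "\<And>g \<alpha>. g \<in> carrier G \<Longrightarrow> \<alpha> \<in> A \<Longrightarrow> X g \<alpha> \<in> A"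
    and stB: "\<And>g \<beta>. g \<in> carrier G \<Longrightarrow> \<beta> \<in> B \<Longrightarrow> X g \<beta> \<in> B"
    and inv: "\<And>g \<gamma>. g \<in> carrier G \<Longrightarrow> \<gamma> \<in> A \<union> B \<Longrightarrow> c (X g \<gamma>) = c \<gamma>"
    and cert: "\<And>\<beta>. \<beta> \<in> B \<Longrightarrow> age_certificate A \<beta> (c \<beta>) (C \<beta>) (\<nu> \<beta>)"
    and total: "\<And>\<alpha>. \<alpha> \<in> A \<Longrightarrow> (\<Sum>\<beta>\<in>B. C \<beta> \<alpha>) \<le> c \<alpha>"
  obtains C' \<nu>' where
    "\<And>\<beta>. \<beta> \<in> B \<Longrightarrow> age_certificate A \<beta> (c \<beta>) (C' \<beta>) (\<nu>' \<beta>)"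
    and "\<And>\<alpha>. \<alpha> \<in> A \<Longrightarrow> (\<Sum>\<beta>\<in>B. C' \<beta> \<alpha>) \<le> c \<alpha>"
    and "\<And>g \<beta> \<alpha>. g \<in> carrier G \<Longrightarrow> C' (X g \<beta>) (X g \<alpha>) = C' \<beta> \<alpha>"
    and "\<And>g \<beta> \<alpha>. g \<in> carrier G \<Longrightarrow> \<nu>' (X g \<beta>) (X g \<alpha>) = \<nu>' \<beta> \<alpha>"
proof -
  interpret group_action G UNIV X by (rule act)
  interpret group G using group_hom group_hom.axioms(1) by blast
  define N where "N = real (card (carrier G))"
  have N: "0 < N" using fin one_closed by (auto simp: N_def card_gt_0_iff)
  define avg where "avg = (\<lambda>(F :: 'a \<Rightarrow> 'a \<Rightarrow> real) \<beta> \<alpha>. (\<Sum>g\<in>carrier G. F (X g \<beta>) (X g \<alpha>)) / N)"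
  have avg_inv: "avg F (X k \<beta>) (X k \<alpha>) = avg F \<beta> \<alpha>" if "k \<in> carrier G" for F k \<beta> \<alpha>
  proof -
    have "(\<Sum>g\<in>carrier G. F (X g (X k \<beta>)) (X g (X k \<alpha>))) =
        (\<Sum>g\<in>carrier G. F (X (g \<otimes>\<^bsub>G\<^esub> k) \<beta>) (X (g \<otimes>\<^bsub>G\<^esub> k) \<alpha>))"
      using that by (intro sum.cong) (auto simp: composition_rule)
    also have "\<dots> = (\<Sum>g\<in>carrier G. F (X g \<beta>) (X g \<alpha>))"
      by (rule sum_group_mult_right[OF that])
    finally show ?thesis by (simp add: avg_def)
  qed
  have bijA: "bij_betw (X g) A A" and bijB: "bij_betw (X g) B B" if "g \<in> carrier G" for g
    using that stA stB by (auto intro!: bij_betw_stable)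
  have reA: "(\<Sum>\<alpha>\<in>A. h (X g \<alpha>)) = (\<Sum>\<alpha>\<in>A. h \<alpha>)" if "g \<in> carrier G"
    for g and h :: "'a \<Rightarrow> 'd::comm_monoid_add"
    by (rule sum.reindex_bij_betw[OF bijA[OF that]])
  have reB: "(\<Sum>\<beta>\<in>B. h (X g \<beta>)) = (\<Sum>\<beta>\<in>B. h \<beta>)" if "g \<in> carrier G"
    for g and h :: "'a \<Rightarrow> real"
    by (rule sum.reindex_bij_betw[OF bijB[OF that]])
  have entry: "0 \<le> C (X g \<beta>) (X g \<alpha>)" "0 \<le> \<nu> (X g \<beta>) (X g \<alpha>)"
      "C (X g \<beta>) (X g \<alpha>) = 0 \<Longrightarrow> \<nu> (X g \<beta>) (X g \<alpha>) = 0"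
    if "g \<in> carrier G" "\<beta> \<in> B" "\<alpha> \<in> A" for g \<beta> \<alpha>
    using cert[OF stB[OF that(1,2)]] stA[OF that(1,3)] by (auto simp: age_certificate_def)
  have "age_certificate A \<beta> (c \<beta>) (avg C \<beta>) (avg \<nu> \<beta>)" if \<beta>: "\<beta> \<in> B" for \<beta>
    unfolding age_certificate_def
  proof (intro conjI ballI impI)
    fix \<alpha> assume \<alpha>: "\<alpha> \<in> A"
    show "0 \<le> avg C \<beta> \<alpha>" "0 \<le> avg \<nu> \<beta> \<alpha>"
      using N entry \<beta> \<alpha> by (auto simp: avg_def intro!: divide_nonneg_pos sum_nonneg)
    assume "avg C \<beta> \<alpha> = 0"
    then have "(\<Sum>g\<in>carrier G. C (X g \<beta>) (X g \<alpha>)) = 0" using N by (simp add: avg_def)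
    \<comment> \<open>An average of nonnegative numbers vanishes only if each of them does, so the
      support condition survives averaging.\<close>
    then have "\<forall>g\<in>carrier G. C (X g \<beta>) (X g \<alpha>) = 0"
      using fin entry(1)[OF _ \<beta> \<alpha>] by (simp add: sum_nonneg_eq_0_iff)
    then show "avg \<nu> \<beta> \<alpha> = 0" using entry(3)[OF _ \<beta> \<alpha>] by (simp add: avg_def)
  next
    have "(\<Sum>\<alpha>\<in>A. \<nu> (X g \<beta>) (X g \<alpha>) *\<^sub>R (\<alpha> - \<beta>)) = 0" if g: "g \<in> carrier G" for g
    proof -
      \<comment> \<open>Under \<open>X g\<close> the sum turns into the balance of the certificate
        at \<open>X g \<beta>\<close>, which is 0; injectivity of \<open>X g\<close> carries this
        back.\<close>
      have "X g (\<Sum>\<alpha>\<in>A. \<nu> (X g \<beta>) (X g \<alpha>) *\<^sub>R (\<alpha> - \<beta>)) =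
          (\<Sum>\<alpha>\<in>A. \<nu> (X g \<beta>) (X g \<alpha>) *\<^sub>R (X g \<alpha> - X g \<beta>))"
        using lin[of g] by (simp add: linear_sum linear_cmul linear_diff)
      also have "\<dots> = (\<Sum>\<alpha>\<in>A. \<nu> (X g \<beta>) \<alpha> *\<^sub>R (\<alpha> - X g \<beta>))" by (rule reA[OF g])
      also have "\<dots> = X g 0"
        using cert[OF stB[OF g \<beta>]] lin[of g] by (simp add: age_certificate_def linear_0)
      finally show ?thesis using inj_prop[OF g] by (simp add: inj_eq)
    qed
    moreover have "(\<Sum>\<alpha>\<in>A. avg \<nu> \<beta> \<alpha> *\<^sub>R (\<alpha> - \<beta>)) =
        (1 / N) *\<^sub>R (\<Sum>g\<in>carrier G. \<Sum>\<alpha>\<in>A. \<nu> (X g \<beta>) (X g \<alpha>) *\<^sub>R (\<alpha> - \<beta>))"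
      by (subst sum.swap) (simp add: avg_def scaleR_sum_right scaleR_sum_left sum_divide_distrib)
    ultimately show "(\<Sum>\<alpha>\<in>A. avg \<nu> \<beta> \<alpha> *\<^sub>R (\<alpha> - \<beta>)) = 0" by simp
  next
    define e where "e = (\<lambda>\<beta> \<alpha>. \<nu> \<beta> \<alpha> * ln (\<nu> \<beta> \<alpha> / C \<beta> \<alpha>) - \<nu> \<beta> \<alpha>)"
    have "avg \<nu> \<beta> \<alpha> * ln (avg \<nu> \<beta> \<alpha> / avg C \<beta> \<alpha>) - avg \<nu> \<beta> \<alpha> \<le> avg e \<beta> \<alpha>" if \<alpha>: "\<alpha> \<in> A" for \<alpha>
    proof -
      define s d where "s = (\<Sum>g\<in>carrier G. \<nu> (X g \<beta>) (X g \<alpha>))"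
        and "d = (\<Sum>g\<in>carrier G. C (X g \<beta>) (X g \<alpha>))"
      \<comment> \<open>Joint convexity is the log-sum inequality over the group; the common factor
        \<open>1 / N\<close> cancels in the ratio and remains only as an outer factor.\<close>
      have "s * ln (s / d) \<le>
          (\<Sum>g\<in>carrier G. \<nu> (X g \<beta>) (X g \<alpha>) * ln (\<nu> (X g \<beta>) (X g \<alpha>) / C (X g \<beta>) (X g \<alpha>)))"
        unfolding s_def d_def by (intro log_sum_inequality fin entry \<beta> \<alpha>)
      then have "(s * ln (s / d) - s) / N \<le> avg e \<beta> \<alpha>"
        unfolding avg_def e_def sum_subtractf s_def[symmetric]
        using N by (intro divide_right_mono) auto
      moreover have "avg \<nu> \<beta> \<alpha> = s / N" "avg C \<beta> \<alpha> = d / N" by (simp_all add: avg_def s_def d_def)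
      ultimately show ?thesis using N by (simp add: diff_divide_distrib)
    qed
    then have "(\<Sum>\<alpha>\<in>A. avg \<nu> \<beta> \<alpha> * ln (avg \<nu> \<beta> \<alpha> / avg C \<beta> \<alpha>) - avg \<nu> \<beta> \<alpha>) \<le> (\<Sum>\<alpha>\<in>A. avg e \<beta> \<alpha>)"
      by (rule sum_mono)
    also have "\<dots> = (\<Sum>g\<in>carrier G. \<Sum>\<alpha>\<in>A. e (X g \<beta>) (X g \<alpha>)) / N"
      by (subst sum.swap) (simp add: avg_def sum_divide_distrib)
    \<comment> \<open>As \<open>X g\<close> permutes A, the inner sum is the full entropy of the
      certificate at \<open>X g \<beta>\<close>, bounded by
      \<open>c (X g \<beta>) = c \<beta>\<close>.\<close>
    also have "\<dots> = (\<Sum>g\<in>carrier G. \<Sum>\<alpha>\<in>A. e (X g \<beta>) \<alpha>) / N" by (simp add: reA)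
    also have "\<dots> \<le> (\<Sum>g\<in>carrier G. c \<beta>) / N"
    proof (intro divide_right_mono sum_mono)
      fix g assume g: "g \<in> carrier G"
      have "(\<Sum>\<alpha>\<in>A. e (X g \<beta>) \<alpha>) \<le> c (X g \<beta>)"
        using cert[OF stB[OF g \<beta>]] by (simp add: age_certificate_def e_def)
      then show "(\<Sum>\<alpha>\<in>A. e (X g \<beta>) \<alpha>) \<le> c \<beta>" using inv[OF g] \<beta> by simp
    qed (use N in simp)
    also have "\<dots> = c \<beta>" using N by (simp add: N_def)
    finally show "(\<Sum>\<alpha>\<in>A. avg \<nu> \<beta> \<alpha> * ln (avg \<nu> \<beta> \<alpha> / avg C \<beta> \<alpha>) - avg \<nu> \<beta> \<alpha>) \<le> c \<beta>" .
  qed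
  moreover have "(\<Sum>\<beta>\<in>B. avg C \<beta> \<alpha>) \<le> c \<alpha>" if \<alpha>: "\<alpha> \<in> A" for \<alpha>
  proof -
    have "(\<Sum>\<beta>\<in>B. avg C \<beta> \<alpha>) = (\<Sum>g\<in>carrier G. \<Sum>\<beta>\<in>B. C (X g \<beta>) (X g \<alpha>)) / N"
      by (subst sum.swap) (simp add: avg_def sum_divide_distrib)
    also have "\<dots> = (\<Sum>g\<in>carrier G. \<Sum>\<beta>\<in>B. C \<beta> (X g \<alpha>)) / N"
      using reB[of _ "\<lambda>\<beta>. C \<beta> (X g \<alpha>)" for g] by simp
    also have "\<dots> \<le> (\<Sum>g\<in>carrier G. c \<alpha>) / N"
    proof (intro divide_right_mono sum_mono)
      fix g assume g: "g \<in> carrier G"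
      show "(\<Sum>\<beta>\<in>B. C \<beta> (X g \<alpha>)) \<le> c \<alpha>" using total[OF stA[OF g \<alpha>]] inv[OF g] \<alpha> by simp
    qed (use N in simp)
    also have "\<dots> = c \<alpha>" using N by (simp add: N_def)
    finally show ?thesis .
  qed
  ultimately show thesis using that[of "avg C" "avg \<nu>"] avg_inv by blast
qed

text \<open>Translates the conditions of the theorem for a single \<beta>, stated for vectors on
  A/Stab(\<beta>), into a certificate whose two functions on A are constant on these orbits. Both
  directions of the theorem pass through it.\<close>

lemma orbit_certificate_iff:
  fixes X :: "'g \<Rightarrow> 'a::real_inner \<Rightarrow> 'a"
  assumes act: "group_action G UNIV X" and finA: "finite A"
    and stA: "\<And>g \<alpha>. g \<in> carrier G \<Longrightarrow> \<alpha> \<in> A \<Longrightarrow> X g \<alpha> \<in> A"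
    and h: "\<And>Orb \<alpha>. Orb \<in> stab_orbits G X A \<beta> \<Longrightarrow> \<alpha> \<in> Orb \<Longrightarrow> h \<alpha> = k Orb"
    and n: "\<And>Orb \<alpha>. Orb \<in> stab_orbits G X A \<beta> \<Longrightarrow> \<alpha> \<in> Orb \<Longrightarrow> n \<alpha> = m Orb"
  shows "(\<forall>Orb\<in>stab_orbits G X A \<beta>. 0 \<le> k Orb \<and> 0 \<le> m Orb) \<and>
      (\<Sum>Orb\<in>stab_orbits G X A \<beta>. m Orb *\<^sub>R (\<Sum>\<alpha>'\<in>Orb. \<alpha>' - \<beta>)) = 0 \<and>
      (\<Sum>Orb\<in>stab_orbits G X A \<beta>.
         ereal (real (card Orb)) * rel_entropy (m Orb) (exp 1 * k Orb)) \<le> ereal b \<longleftrightarrow>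
    age_certificate A \<beta> b h n"
proof -
  interpret group_action G UNIV X by (rule act)
  let ?O = "stab_orbits G X A \<beta>"
  note stable = finA subset_UNIV stA UNIV_I
  have finO: "finite ?O" and Orb: "\<And>Orb. Orb \<in> ?O \<Longrightarrow> finite Orb \<and> Orb \<noteq> {} \<and> Orb \<subseteq> A"
    using stab_orbits_finite_nonempty[OF stable] by auto
  have all: "(\<forall>Orb\<in>?O. P (k Orb) (m Orb)) \<longleftrightarrow> (\<forall>\<alpha>\<in>A. P (h \<alpha>) (n \<alpha>))" for P
  proof -
    have "\<alpha> \<in> orbit (G\<lparr>carrier := stabilizer G X \<beta>\<rparr>) X \<alpha>" for \<alpha>
      using group_action.orbit_refl[OF induced_action[OF stabilizer_subgroup[of \<beta>]], of \<alpha>]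
      by simp
    then have cover: "\<exists>Orb\<in>?O. \<alpha> \<in> Orb" if "\<alpha> \<in> A" for \<alpha>
      using that by (auto simp: stab_orbits_def orbits_def)
    show ?thesis
    proof (intro iffI ballI)
      fix \<alpha> assume P: "\<forall>Orb\<in>?O. P (k Orb) (m Orb)" and "\<alpha> \<in> A"
      then obtain Orb where "Orb \<in> ?O" "\<alpha> \<in> Orb" using cover by blast
      then show "P (h \<alpha>) (n \<alpha>)" using P h n by simp
    next
      fix Orb assume P: "\<forall>\<alpha>\<in>A. P (h \<alpha>) (n \<alpha>)" and O: "Orb \<in> ?O"
      then obtain \<alpha> where "\<alpha> \<in> Orb" "\<alpha> \<in> A" using Orb by blast
      then show "P (k Orb) (m Orb)" using P h[OF O] n[OF O] by force
    qed
  qed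
  have "(\<Sum>Orb\<in>?O. m Orb *\<^sub>R (\<Sum>\<alpha>'\<in>Orb. \<alpha>' - \<beta>)) = (\<Sum>Orb\<in>?O. \<Sum>\<alpha>\<in>Orb. n \<alpha> *\<^sub>R (\<alpha> - \<beta>))"
    by (intro sum.cong) (simp_all add: n scaleR_sum_right)
  also have "\<dots> = (\<Sum>\<alpha>\<in>A. n \<alpha> *\<^sub>R (\<alpha> - \<beta>))" by (rule sum_over_stab_orbits[OF stable])
  finally have balance: "(\<Sum>Orb\<in>?O. m Orb *\<^sub>R (\<Sum>\<alpha>'\<in>Orb. \<alpha>' - \<beta>)) = (\<Sum>\<alpha>\<in>A. n \<alpha> *\<^sub>R (\<alpha> - \<beta>))" .
  have ent: "(\<Sum>Orb\<in>?O. real (card Orb) * (m Orb * ln (m Orb / k Orb) - m Orb)) =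
      (\<Sum>\<alpha>\<in>A. n \<alpha> * ln (n \<alpha> / h \<alpha>) - n \<alpha>)"
    by (rule sum_stab_orbits_card[OF stable]) (auto simp: h n)
  have ent_iff: "(\<Sum>Orb\<in>?O. ereal (real (card Orb)) * rel_entropy (m Orb) (exp 1 * k Orb)) \<le> ereal b \<longleftrightarrow>
      (\<forall>Orb\<in>?O. k Orb = 0 \<longrightarrow> m Orb = 0) \<and> (\<Sum>\<alpha>\<in>A. n \<alpha> * ln (n \<alpha> / h \<alpha>) - n \<alpha>) \<le> b"
    if "\<forall>Orb\<in>?O. 0 \<le> k Orb \<and> 0 \<le> m Orb"
    unfolding ent[symmetric] using that Orb
    by (intro sum_rel_entropy_le_iff finO) (auto simp: card_gt_0_iff)
  have sign: "(\<forall>Orb\<in>?O. 0 \<le> k Orb \<and> 0 \<le> m Orb) \<longleftrightarrow> (\<forall>\<alpha>\<in>A. 0 \<le> h \<alpha> \<and> 0 \<le> n \<alpha>)"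
    by (rule all)
  have supp: "(\<forall>Orb\<in>?O. k Orb = 0 \<longrightarrow> m Orb = 0) \<longleftrightarrow> (\<forall>\<alpha>\<in>A. h \<alpha> = 0 \<longrightarrow> n \<alpha> = 0)"
    by (rule all)
  show ?thesis
  \<comment> \<open>The translation of the extended-real inequality is available only for
    nonnegative vectors; otherwise both sides fail by their sign clauses.\<close>
  proof (cases "\<forall>Orb\<in>?O. 0 \<le> k Orb \<and> 0 \<le> m Orb")
    case True
    then have "\<forall>\<alpha>\<in>A. 0 \<le> h \<alpha> \<and> 0 \<le> n \<alpha>" using sign by simp
    with True show ?thesis
      unfolding age_certificate_def balance ent_iff[OF True] supp by blast
  next
    case False
    then have "\<not> (\<forall>\<alpha>\<in>A. 0 \<le> h \<alpha> \<and> 0 \<le> n \<alpha>)" using sign by simp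
    with False show ?thesis unfolding age_certificate_def by blast
  qed
qed

text \<open>Linearity maps \<alpha> - \<beta> to the difference of the images, so the balance is
  carried along, and the entropy sum is only reindexed by a permutation of A.\<close>

lemma age_certificate_transport:
  fixes X :: "'g \<Rightarrow> 'a::real_inner \<Rightarrow> 'a"
  assumes act: "group_action G UNIV X" and lin: "linear (X g)" and g: "g \<in> carrier G"
    and stA: "\<And>g \<alpha>. g \<in> carrier G \<Longrightarrow> \<alpha> \<in> A \<Longrightarrow> X g \<alpha> \<in> A"
    and cert: "age_certificate A \<beta> b h n"
  shows "age_certificate A (X g \<beta>) b (\<lambda>\<alpha>. h (X (inv\<^bsub>G\<^esub> g) \<alpha>)) (\<lambda>\<alpha>. n (X (inv\<^bsub>G\<^esub> g) \<alpha>))"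
proof -
  interpret group_action G UNIV X by (rule act)
  interpret group G using group_hom group_hom.axioms(1) by blast
  have inv: "X (inv\<^bsub>G\<^esub> g) (X g \<alpha>) = \<alpha>" for \<alpha> using orbit_sym_aux[OF g] by simp
  have re: "(\<Sum>\<alpha>\<in>A. F \<alpha>) = (\<Sum>\<alpha>\<in>A. F (X g \<alpha>))" for F :: "'a \<Rightarrow> 'd::comm_monoid_add"
    by (rule sum.reindex_bij_betw[symmetric, OF bij_betw_stable]) (use stA g in auto)
  have "(\<Sum>\<alpha>\<in>A. n (X (inv\<^bsub>G\<^esub> g) \<alpha>) *\<^sub>R (\<alpha> - X g \<beta>)) = (\<Sum>\<alpha>\<in>A. n \<alpha> *\<^sub>R (X g \<alpha> - X g \<beta>))"
    by (subst re) (simp add: inv)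
  also have "\<dots> = X g (\<Sum>\<alpha>\<in>A. n \<alpha> *\<^sub>R (\<alpha> - \<beta>))"
    using lin by (simp add: linear_sum linear_cmul linear_diff)
  also have "\<dots> = 0" using cert lin by (simp add: age_certificate_def linear_0)
  finally have "(\<Sum>\<alpha>\<in>A. n (X (inv\<^bsub>G\<^esub> g) \<alpha>) *\<^sub>R (\<alpha> - X g \<beta>)) = 0" .
  moreover have "(\<Sum>\<alpha>\<in>A. n (X (inv\<^bsub>G\<^esub> g) \<alpha>) * ln (n (X (inv\<^bsub>G\<^esub> g) \<alpha>) / h (X (inv\<^bsub>G\<^esub> g) \<alpha>)) -
      n (X (inv\<^bsub>G\<^esub> g) \<alpha>)) \<le> b"
    by (subst re) (use cert in \<open>simp add: inv age_certificate_def\<close>)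
  ultimately show ?thesis using cert stA[OF inv_closed[OF g]] by (auto simp: age_certificate_def)
qed

subsection \<open>The dual action\<close>

context
  fixes G :: "('g, 'm) monoid_scheme" and \<phi> :: "'g \<Rightarrow> real ^ 'n ^ 'n"
  assumes grp: "group G" and hom: "\<phi> \<in> hom G GL"
begin

text \<open>Allows equations between exponents to be checked by pairing with an arbitrary x, without
  computing adjoint matrices.\<close>

lemma inner_dual_act:
  "dual_act G \<phi> \<sigma> \<alpha> \<bullet> x = \<alpha> \<bullet> (\<phi> (inv\<^bsub>G\<^esub> \<sigma>) *v x)"
  unfolding dual_act_def
  using adjoint_works[OF matrix_vector_mul_linear, of x "\<phi> (inv\<^bsub>G\<^esub> \<sigma>)" \<alpha>] by (simp add: inner_commute)

lemma linear_dual_act: "linear (dual_act G \<phi> \<sigma>)"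
  unfolding dual_act_def[abs_def] by (simp add: adjoint_linear)

text \<open>Inversion and adjoint each reverse the order of factors, so together they give a left
  action.\<close>

lemma dual_act_mult:
  assumes "\<sigma> \<in> carrier G" and "\<tau> \<in> carrier G"
  shows "dual_act G \<phi> (\<sigma> \<otimes>\<^bsub>G\<^esub> \<tau>) \<alpha> = dual_act G \<phi> \<sigma> (dual_act G \<phi> \<tau> \<alpha>)"
proof -
  interpret group G by (rule grp)
  have "\<phi> (inv\<^bsub>G\<^esub> (\<sigma> \<otimes>\<^bsub>G\<^esub> \<tau>)) = \<phi> (inv\<^bsub>G\<^esub> \<tau>) ** \<phi> (inv\<^bsub>G\<^esub> \<sigma>)"
    using hom_mult[OF hom] assms by (simp add: inv_mult_group GL_def)
  then show ?thesis
    by - (rule vector_eq_rdot[THEN iffD1], simp add: inner_dual_act matrix_vector_mul_assoc)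
qed

text \<open>The matrix of the unit is idempotent and invertible, hence the identity matrix.\<close>

lemma dual_act_one: "dual_act G \<phi> \<one>\<^bsub>G\<^esub> \<alpha> = \<alpha>"
proof -
  interpret group G by (rule grp)
  let ?M = "\<phi> \<one>\<^bsub>G\<^esub>"
  have "?M ** ?M = ?M" using hom_mult[OF hom, of "\<one>\<^bsub>G\<^esub>" "\<one>\<^bsub>G\<^esub>"] by (simp add: GL_def)
  moreover have "invertible ?M" using hom_in_carrier[OF hom, of "\<one>\<^bsub>G\<^esub>"] by (simp add: GL_def)
  then obtain N where N: "N ** ?M = mat 1" by (auto simp: invertible_def)
  moreover have "(N ** ?M) ** ?M = N ** (?M ** ?M)" by (rule matrix_mul_assoc[symmetric])
  ultimately have "?M = mat 1" by (simp add: N)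
  then show ?thesis
    by - (rule vector_eq_rdot[THEN iffD1], simp add: inner_dual_act)
qed

lemma group_action_dual_act: "group_action G UNIV (dual_act G \<phi>)"
proof -
  interpret group G by (rule grp)
  have inv: "dual_act G \<phi> (inv\<^bsub>G\<^esub> \<sigma>) (dual_act G \<phi> \<sigma> \<alpha>) = \<alpha>"
    "dual_act G \<phi> \<sigma> (dual_act G \<phi> (inv\<^bsub>G\<^esub> \<sigma>) \<alpha>) = \<alpha>" if "\<sigma> \<in> carrier G" for \<sigma> \<alpha>
    using that by (simp_all add: dual_act_one flip: dual_act_mult)
  have bij: "bij (dual_act G \<phi> \<sigma>)" if "\<sigma> \<in> carrier G" for \<sigma>
    by (rule o_bij[of "dual_act G \<phi> (inv\<^bsub>G\<^esub> \<sigma>)"]) (use inv[OF that] in \<open>auto simp: fun_eq_iff\<close>)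
  have "dual_act G \<phi> \<in> hom G (BijGroup UNIV)"
    using bij by (auto simp: hom_def BijGroup_def Bij_def compose_def dual_act_mult fun_eq_iff)
  then show ?thesis
    by (simp add: group_action_def group_hom_def group_hom_axioms_def grp group_BijGroup)
qed

end

section \<open>Invariant signomials and the symmetric certificate\<close>

text \<open>Invariance is applied to the inverse of g, which acts on exponents by \<gamma> \<mapsto>
  g^-1 \<gamma>; reindexing by g moves the action onto the coefficients, which are then compared by
  linear independence.\<close>

lemma coefficients_invariant:
  fixes \<phi> :: "'g \<Rightarrow> real ^ 'n ^ 'n"
  assumes grp: "group G" and hom: "\<phi> \<in> hom G GL" and finE: "finite E"
    and stE: "\<And>g \<gamma>. g \<in> carrier G \<Longrightarrow> \<gamma> \<in> E \<Longrightarrow> dual_act G \<phi> g \<gamma> \<in> E"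
    and f: "\<And>x. f x = (\<Sum>\<gamma>\<in>E. c \<gamma> * exp (\<gamma> \<bullet> x))"
    and inv: "\<forall>\<sigma>\<in>carrier G. fun_act G \<phi> \<sigma> f = f"
    and g: "g \<in> carrier G" and \<gamma>: "\<gamma> \<in> E"
  shows "c (dual_act G \<phi> g \<gamma>) = c \<gamma>"
proof (rule exp_inner_coeff_eq[OF finE _ \<gamma>])
  interpret group G by (rule grp)
  interpret group_action G UNIV "dual_act G \<phi>" by (rule group_action_dual_act[OF grp hom])
  let ?h = "inv\<^bsub>G\<^esub> g"
  fix x
  have "(\<Sum>\<gamma>\<in>E. c \<gamma> * exp (\<gamma> \<bullet> x)) = fun_act G \<phi> ?h f x" using inv g f by simp
  also have "\<dots> = (\<Sum>\<gamma>\<in>E. c \<gamma> * exp (dual_act G \<phi> ?h \<gamma> \<bullet> x))"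
    by (simp add: fun_act_def f inner_dual_act[OF grp hom])
  also have "\<dots> = (\<Sum>\<gamma>\<in>E. c (dual_act G \<phi> g \<gamma>) * exp (dual_act G \<phi> ?h (dual_act G \<phi> g \<gamma>) \<bullet> x))"
    by (rule sum.reindex_bij_betw[symmetric, OF bij_betw_stable]) (use stE g in auto)
  also have "\<dots> = (\<Sum>\<gamma>\<in>E. c (dual_act G \<phi> g \<gamma>) * exp (\<gamma> \<bullet> x))"
    using orbit_sym_aux[OF g] by simp
  finally show "(\<Sum>\<gamma>\<in>E. c (dual_act G \<phi> g \<gamma>) * exp (\<gamma> \<bullet> x)) = (\<Sum>\<gamma>\<in>E. c \<gamma> * exp (\<gamma> \<bullet> x))" by simp
qed

theorem corollary4p3:
  fixes G :: "('g, 'm) monoid_scheme"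
    and \<phi> :: "'g \<Rightarrow> real ^ 'n ^ 'n"
    and A B A_hat B_hat :: "(real ^ 'n) set"
    and c :: "real ^ 'n \<Rightarrow> real"
    and f :: "real ^ 'n \<Rightarrow> real"
  assumes "group G" and "finite (carrier G)"
    and "\<phi> \<in> hom G GL"
    and "finite A" and "A \<noteq> {}" and "finite B" and "B \<noteq> {}" and "A \<inter> B = {}"
    and "\<forall>\<alpha>\<in>A. c \<alpha> > 0" and "\<forall>\<beta>\<in>B. c \<beta> < 0"
    and "f = (\<lambda>x. (\<Sum>\<alpha>\<in>A. c \<alpha> * exp (\<alpha> \<bullet> x)) + (\<Sum>\<beta>\<in>B. c \<beta> * exp (\<beta> \<bullet> x)))"
    and "\<forall>\<sigma>\<in>carrier G. fun_act G \<phi> \<sigma> f = f"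
    and "orbit_reps G (dual_act G \<phi>) A A_hat"
    and "orbit_reps G (dual_act G \<phi>) B B_hat"
  shows "f \<in> C_SAGE A B \<longleftrightarrow>
    (\<exists>(cc :: real ^ 'n \<Rightarrow> (real ^ 'n) set \<Rightarrow> real) (\<nu> :: real ^ 'n \<Rightarrow> (real ^ 'n) set \<Rightarrow> real).
       (\<forall>\<beta>\<in>B_hat. \<forall>Orb\<in>stab_orbits G (dual_act G \<phi>) A \<beta>. 0 \<le> cc \<beta> Orb \<and> 0 \<le> \<nu> \<beta> Orb) \<and>
       (\<forall>\<beta>\<in>B_hat.
          (\<Sum>Orb\<in>stab_orbits G (dual_act G \<phi>) A \<beta>. \<nu> \<beta> Orb *\<^sub>R (\<Sum>\<alpha>'\<in>Orb. \<alpha>' - \<beta>)) = 0) \<and>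
       (\<forall>\<beta>\<in>B_hat.
          (\<Sum>Orb\<in>stab_orbits G (dual_act G \<phi>) A \<beta>.
             ereal (real (card Orb)) * rel_entropy (\<nu> \<beta> Orb) (exp 1 * cc \<beta> Orb)) \<le> ereal (c \<beta>)) \<and>
       (\<forall>\<alpha>\<in>A_hat.
          (\<Sum>\<beta>\<in>B_hat.
             real (card (stabilizer G (dual_act G \<phi>) \<alpha>)) / real (card (stabilizer G (dual_act G \<phi>) \<beta>)) *
             (\<Sum>Orb\<in>stab_orbits G (dual_act G \<phi>) (orbit G (dual_act G \<phi>) \<alpha>) \<beta>.
                real (card Orb) * cc \<beta> Orb)) \<le> c \<alpha>))"
proof -
  define X where "X = dual_act G \<phi>"
  note fin = assms(2) and finA = assms(4) and finB = assms(6)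
  have act: "group_action G UNIV X"
    unfolding X_def by (rule group_action_dual_act[OF assms(1,3)])
  interpret group_action G UNIV X by (rule act)
  interpret group G by (rule assms(1))
  have lin: "linear (X g)" for g unfolding X_def by (rule linear_dual_act[OF assms(1,3)])
  have repsA: "orbit_reps G X A A_hat" and repsB: "orbit_reps G X B B_hat"
    using assms(13,14) by (simp_all add: X_def)
  have hatA: "A_hat \<subseteq> A" and hatB: "B_hat \<subseteq> B" using repsA repsB by (auto simp: orbit_reps_def)
  have stA: "X g \<alpha> \<in> A" if "g \<in> carrier G" "\<alpha> \<in> A" for g \<alpha>
    by (rule orbit_reps_stable[OF subset_UNIV repsA that])
  have stB: "X g \<beta> \<in> B" if "g \<in> carrier G" "\<beta> \<in> B" for g \<beta>
    by (rule orbit_reps_stable[OF subset_UNIV repsB that])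
  have c_inv: "c (X g \<gamma>) = c \<gamma>" if "g \<in> carrier G" "\<gamma> \<in> A \<union> B" for g \<gamma>
    unfolding X_def
  proof (rule coefficients_invariant[OF assms(1,3) _ _ _ assms(12) that])
    show "f x = (\<Sum>\<gamma>\<in>A \<union> B. c \<gamma> * exp (\<gamma> \<bullet> x))" for x
      using finA finB assms(8) by (simp add: assms(11) sum.union_disjoint)
  qed (use finA finB stA stB in \<open>auto simp: X_def\<close>)
  have "f \<in> C_SAGE A B \<longleftrightarrow>
    (\<exists>C \<nu>. (\<forall>\<beta>\<in>B. age_certificate A \<beta> (c \<beta>) (C \<beta>) (\<nu> \<beta>)) \<and> (\<forall>\<alpha>\<in>A. (\<Sum>\<beta>\<in>B. C \<beta> \<alpha>) \<le> c \<alpha>))"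
    by (rule C_SAGE_iff_age_certificate[OF finA finB assms(7,8,10,11)])
  also have "\<dots> \<longleftrightarrow> (\<exists>cc \<nu>.
      (\<forall>\<beta>\<in>B_hat. (\<forall>Orb\<in>stab_orbits G X A \<beta>. 0 \<le> cc \<beta> Orb \<and> 0 \<le> \<nu> \<beta> Orb) \<and>
        (\<Sum>Orb\<in>stab_orbits G X A \<beta>. \<nu> \<beta> Orb *\<^sub>R (\<Sum>\<alpha>'\<in>Orb. \<alpha>' - \<beta>)) = 0 \<and>
        (\<Sum>Orb\<in>stab_orbits G X A \<beta>.
           ereal (real (card Orb)) * rel_entropy (\<nu> \<beta> Orb) (exp 1 * cc \<beta> Orb)) \<le> ereal (c \<beta>)) \<and>
      (\<forall>\<alpha>\<in>A_hat. (\<Sum>\<beta>\<in>B_hat. real (card (stabilizer G X \<alpha>)) / real (card (stabilizer G X \<beta>)) *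
        (\<Sum>Orb\<in>stab_orbits G X (orbit G X \<alpha>) \<beta>. real (card Orb) * cc \<beta> Orb)) \<le> c \<alpha>))"
    (is "?certs \<longleftrightarrow> (\<exists>cc \<nu>. ?local cc \<nu> \<and> ?total cc)")
  proof
    assume ?certs
    then obtain C \<nu> where
      "\<And>\<beta>. \<beta> \<in> B \<Longrightarrow> age_certificate A \<beta> (c \<beta>) (C \<beta>) (\<nu> \<beta>)"
      "\<And>\<alpha>. \<alpha> \<in> A \<Longrightarrow> (\<Sum>\<beta>\<in>B. C \<beta> \<alpha>) \<le> c \<alpha>" by blast
    from invariant_age_certificate[OF act fin lin finA finB stA stB c_inv this]
    obtain C \<nu> where cert: "\<And>\<beta>. \<beta> \<in> B \<Longrightarrow> age_certificate A \<beta> (c \<beta>) (C \<beta>) (\<nu> \<beta>)"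
      and total: "\<And>\<alpha>. \<alpha> \<in> A \<Longrightarrow> (\<Sum>\<beta>\<in>B. C \<beta> \<alpha>) \<le> c \<alpha>"
      and C_inv: "\<And>g \<beta> \<alpha>. g \<in> carrier G \<Longrightarrow> C (X g \<beta>) (X g \<alpha>) = C \<beta> \<alpha>"
      and \<nu>_inv: "\<And>g \<beta> \<alpha>. g \<in> carrier G \<Longrightarrow> \<nu> (X g \<beta>) (X g \<alpha>) = \<nu> \<beta> \<alpha>" by blast
    \<comment> \<open>The choice is immaterial: two points of an orbit differ by some g fixing
      \<beta>, and diagonal invariance under this g leaves the first argument in place.\<close>
    define cc where "cc = (\<lambda>\<beta> Orb. C \<beta> (SOME \<alpha>. \<alpha> \<in> Orb))"
    define \<mu> where "\<mu> = (\<lambda>\<beta> Orb. \<nu> \<beta> (SOME \<alpha>. \<alpha> \<in> Orb))"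
    have const: "C \<beta> \<alpha> = cc \<beta> Orb" "\<nu> \<beta> \<alpha> = \<mu> \<beta> Orb"
      if Orb: "Orb \<in> stab_orbits G X A \<beta>" "\<alpha> \<in> Orb" for Orb \<alpha> \<beta>
    proof -
      have some: "(SOME \<alpha>. \<alpha> \<in> Orb) \<in> Orb" using Orb(2) by (rule someI)
      obtain g where g: "g \<in> carrier G" "X g \<beta> = \<beta>" "(SOME \<alpha>. \<alpha> \<in> Orb) = X g \<alpha>"
        using stab_orbits_memberE[OF UNIV_I subset_UNIV Orb some] by metis
      show "C \<beta> \<alpha> = cc \<beta> Orb" "\<nu> \<beta> \<alpha> = \<mu> \<beta> Orb"
        using C_inv[OF g(1), of \<beta> \<alpha>] \<nu>_inv[OF g(1), of \<beta> \<alpha>] by (simp_all add: cc_def \<mu>_def g)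
    qed
    have "?local cc \<mu>"
    proof
      fix \<beta> assume "\<beta> \<in> B_hat"
      then have "age_certificate A \<beta> (c \<beta>) (C \<beta>) (\<nu> \<beta>)" using cert hatB by blast
      then show "(\<forall>Orb\<in>stab_orbits G X A \<beta>. 0 \<le> cc \<beta> Orb \<and> 0 \<le> \<mu> \<beta> Orb) \<and>
        (\<Sum>Orb\<in>stab_orbits G X A \<beta>. \<mu> \<beta> Orb *\<^sub>R (\<Sum>\<alpha>'\<in>Orb. \<alpha>' - \<beta>)) = 0 \<and>
        (\<Sum>Orb\<in>stab_orbits G X A \<beta>.
           ereal (real (card Orb)) * rel_entropy (\<mu> \<beta> Orb) (exp 1 * cc \<beta> Orb)) \<le> ereal (c \<beta>)"
        by (subst orbit_certificate_iff[OF act finA stA const])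
    qed
    moreover have "?total cc"
    proof
      fix \<alpha> assume "\<alpha> \<in> A_hat"
      then have \<alpha>: "\<alpha> \<in> A" using hatA by blast
      have "(\<Sum>\<beta>\<in>B_hat. real (card (stabilizer G X \<alpha>)) / real (card (stabilizer G X \<beta>)) *
          (\<Sum>Orb\<in>stab_orbits G X (orbit G X \<alpha>) \<beta>. real (card Orb) * cc \<beta> Orb)) =
          (\<Sum>\<beta>\<in>B_hat. (\<Sum>g\<in>carrier G. C \<beta> (X g \<alpha>)) / card (stabilizer G X \<beta>))"
        by (intro sum.cong refl weighted_orbit_sum[OF fin subset_UNIV UNIV_I \<alpha> stA const(1)])
      \<comment> \<open>Diagonal invariance of C trades the action on \<alpha> for one on \<beta>,
        which unfolds the representatives to all of B.\<close>
      also have "\<dots> = (\<Sum>\<beta>\<in>B. C \<beta> \<alpha>)"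
      proof (rule sum_equivariant[OF fin finB subset_UNIV repsB])
        fix \<beta> g assume g: "g \<in> carrier G"
        show "C (X g \<beta>) \<alpha> = C \<beta> (X (inv\<^bsub>G\<^esub> g) \<alpha>)"
          using C_inv[OF inv_closed[OF g], of "X g \<beta>" \<alpha>] orbit_sym_aux[OF g UNIV_I refl] by simp
      qed
      also have "\<dots> \<le> c \<alpha>" by (rule total[OF \<alpha>])
      finally show "(\<Sum>\<beta>\<in>B_hat. real (card (stabilizer G X \<alpha>)) / real (card (stabilizer G X \<beta>)) *
          (\<Sum>Orb\<in>stab_orbits G X (orbit G X \<alpha>) \<beta>. real (card Orb) * cc \<beta> Orb)) \<le> c \<alpha>" .
    qed
    ultimately show "\<exists>cc \<nu>. ?local cc \<nu> \<and> ?total cc" by blast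
  next
    assume "\<exists>cc \<nu>. ?local cc \<nu> \<and> ?total cc"
    then obtain cc \<mu> where local_cond: "?local cc \<mu>" and total: "?total cc" by blast
    let ?orb = "\<lambda>\<beta>. orbit (G\<lparr>carrier := stabilizer G X \<beta>\<rparr>) X"
    \<comment> \<open>The given vectors are pulled back from orbits to points.\<close>
    define h where "h = (\<lambda>\<beta> \<alpha>. cc \<beta> (?orb \<beta> \<alpha>))"
    define n where "n = (\<lambda>\<beta> \<alpha>. \<mu> \<beta> (?orb \<beta> \<alpha>))"
    have const: "h \<beta> \<alpha> = cc \<beta> Orb" "n \<beta> \<alpha> = \<mu> \<beta> Orb"
      if "Orb \<in> stab_orbits G X A \<beta>" "\<alpha> \<in> Orb" for Orb \<alpha> \<beta>
      using stab_orbits_member_eq[OF subset_UNIV UNIV_I that] by (simp_all add: h_def n_def)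
    \<comment> \<open>This gives the invariance under the stabiliser of \<beta> that makes the
      equivariant extension well defined.\<close>
    have orb_inv: "?orb \<beta> (X g \<alpha>) = ?orb \<beta> \<alpha>" if "g \<in> carrier G" "X g \<beta> = \<beta>" for g \<beta> \<alpha>
    proof -
      interpret H: group_action "G\<lparr>carrier := stabilizer G X \<beta>\<rparr>" UNIV X
        by (rule induced_action[OF stabilizer_subgroup[OF UNIV_I]])
      show ?thesis
        by (rule H.orbit_eq[OF UNIV_I]) (use that in \<open>auto simp: orbit_def stabilizer_def\<close>)
    qed
    obtain C where C: "\<And>\<beta> g \<alpha>. \<beta> \<in> B_hat \<Longrightarrow> g \<in> carrier G \<Longrightarrow> C (X g \<beta>) \<alpha> = h \<beta> (X (inv\<^bsub>G\<^esub> g) \<alpha>)"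
      using equivariant_extension[OF subset_UNIV repsB, of h] orb_inv unfolding h_def by (metis UNIV_I)
    obtain \<nu> where \<nu>: "\<And>\<beta> g \<alpha>. \<beta> \<in> B_hat \<Longrightarrow> g \<in> carrier G \<Longrightarrow> \<nu> (X g \<beta>) \<alpha> = n \<beta> (X (inv\<^bsub>G\<^esub> g) \<alpha>)"
      using equivariant_extension[OF subset_UNIV repsB, of n] orb_inv unfolding n_def by (metis UNIV_I)
    have "age_certificate A \<beta> (c \<beta>) (C \<beta>) (\<nu> \<beta>)" if \<beta>B: "\<beta> \<in> B" for \<beta>
    proof -
      obtain g \<beta>' where g: "g \<in> carrier G" and \<beta>': "\<beta>' \<in> B_hat" and \<beta>: "\<beta> = X g \<beta>'"
        using orbit_reps_cover[OF subset_UNIV repsB \<beta>B] by blast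
      have "age_certificate A \<beta>' (c \<beta>') (h \<beta>') (n \<beta>')"
        by (subst orbit_certificate_iff[OF act finA stA const, symmetric]) (use local_cond \<beta>' in auto)
      then have "age_certificate A (X g \<beta>') (c \<beta>')
          (\<lambda>\<alpha>. h \<beta>' (X (inv\<^bsub>G\<^esub> g) \<alpha>)) (\<lambda>\<alpha>. n \<beta>' (X (inv\<^bsub>G\<^esub> g) \<alpha>))"
        by (rule age_certificate_transport[OF act lin g, rotated]) (rule stA)
      moreover have "C \<beta> = (\<lambda>\<alpha>. h \<beta>' (X (inv\<^bsub>G\<^esub> g) \<alpha>))" "\<nu> \<beta> = (\<lambda>\<alpha>. n \<beta>' (X (inv\<^bsub>G\<^esub> g) \<alpha>))"
        using C[OF \<beta>' g] \<nu>[OF \<beta>' g] \<beta> by auto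
      moreover have "c \<beta> = c \<beta>'" using c_inv[OF g, of \<beta>'] \<beta>' hatB \<beta> by auto
      ultimately show ?thesis by (simp add: \<beta>)
    qed
    moreover have "(\<Sum>\<beta>\<in>B. C \<beta> \<alpha>) \<le> c \<alpha>" if \<alpha>A: "\<alpha> \<in> A" for \<alpha>
    proof -
      obtain k \<alpha>' where k: "k \<in> carrier G" and \<alpha>': "\<alpha>' \<in> A_hat" and \<alpha>: "\<alpha> = X k \<alpha>'"
        using orbit_reps_cover[OF subset_UNIV repsA \<alpha>A] by blast
      have \<alpha>'A: "\<alpha>' \<in> A" using \<alpha>' hatA by blast
      have "(\<Sum>\<beta>\<in>B. C \<beta> \<alpha>) =
          (\<Sum>\<beta>\<in>B_hat. (\<Sum>g\<in>carrier G. h \<beta> (X g \<alpha>)) / card (stabilizer G X \<beta>))"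
        using sum_equivariant[OF fin finB subset_UNIV repsB, where H = C and h = h and y = \<alpha>] C by simp
      \<comment> \<open>The group sum depends only on the orbit of \<alpha>, so \<alpha> can be
        exchanged for its representative, the only place where the bound is given.\<close>
      also have "\<dots> = (\<Sum>\<beta>\<in>B_hat. (\<Sum>g\<in>carrier G. h \<beta> (X g \<alpha>')) / card (stabilizer G X \<beta>))"
        unfolding \<alpha> by (simp add: sum_group_shift[OF k UNIV_I])
      also have "\<dots> = (\<Sum>\<beta>\<in>B_hat. real (card (stabilizer G X \<alpha>')) / real (card (stabilizer G X \<beta>)) *
          (\<Sum>Orb\<in>stab_orbits G X (orbit G X \<alpha>') \<beta>. real (card Orb) * cc \<beta> Orb))"
        by (intro sum.cong refl weighted_orbit_sum[OF fin subset_UNIV UNIV_I \<alpha>'A stA const(1), symmetric])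
      also have "\<dots> \<le> c \<alpha>'" using total \<alpha>' by blast
      also have "\<dots> = c \<alpha>" using c_inv[OF k, of \<alpha>'] \<alpha>'A \<alpha> by simp
      finally show ?thesis .
    qed
    ultimately show ?certs by blast
  qed
  finally show ?thesis unfolding X_def by (simp only: ball_conj_distrib conj_assoc)
qed

end
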